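(* Let $K$ and $K'$ be oriented virtual knots. Then the following are equivalent. (i) $W_K(t)=W_{K'}(t)$. (ii) $K$ and $K'$ are related by a finite sequence of shell moves (that is, some, equivalently any, Gauss diagrams of $K$ and $K'$ are related by a finite sequence of Reidemeister moves R1, R2, R3 and shell moves S1, S2).
   Context: Gauss diagrams. A Gauss diagram is a disjoint union of oriented circles $C_1,\dots,C_\mu$ together with finitely many chords. Each chord joins two points of the circles (its endpoints; all endpoints of all chords are distinct), is oriented from its initial to its terminal endpoint, and carries a sign $\varepsilon\in\{+1,-1\}$. For a chord of sign $\varepsilon$, the initial endpoint is given the sign $-\varepsilon$ and the terminal endpoint the sign $\varepsilon$. Only the cyclic order of the endpoints on each circle matters. A chord is a self-chord if both endpoints lie on the same circle. Endpoints are adjacent (consecutive) if they bound an arc of a circle containing no other endpoint in its interior. Reidemeister moves. R1: insert or delete a self-chord (of any sign and orientation) whose two endpoints are adjacent. R2: insert or delete two chords of opposite signs whose initial endpoints are adjacent and whose terminal endpoints are adjacent (in any order). R3: let $a,b,c$ be three chords of the same sign $\varepsilon$ such that, along the orientation of the circles, the initial endpoint of $a$ is immediately followed by the initial endpoint of $b$, the terminal endpoint of $a$ is immediately followed by the initial endpoint of $c$, and the terminal endpoint of $b$ is immediately followed by the terminal endpoint of $c$; exchange the two endpoints in each of these three adjacent pairs (or the inverse). An oriented $\mu$-component virtual link is an equivalence class of Gauss diagrams with $\mu$ circles under R1, R2, R3; for $\mu=1$ it is an oriented virtual knot. Shells. Shells for a chord $\gamma$ at an endpoint $p$ of $\gamma$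 are self-chords surrounding $p$ in parallel: for shells $s_1,\dots,s_k$ the consecutive endpoints on the circle are: one endpoint of $s_k$, ..., one endpoint of $s_1$, then $p$, then the other endpoint of $s_1$, ..., the other endpoint of $s_k$. If $p$ has positive sign, each shell is oriented as the circle (its initial endpoint precedes $p$ and its terminal endpoint follows $p$); if $p$ has negative sign, each shell is oriented oppositely. The sign of a shell is arbitrary. Shell moves. S1: delete a shell immediately surrounding one endpoint of a chord $\gamma$, and insert a shell of the same sign immediately surrounding the other endpoint of $\gamma$. S2: let $p,q$ be endpoints of two distinct chords with $p$ immediately followed by $q$ along the circle, with signs $\varepsilon_p,\varepsilon_q$; exchange their positions, and add a shell of sign $\varepsilon_p\varepsilon_q$ immediately surrounding $p$ and a shell of sign $-\varepsilon_p\varepsilon_q$ immediately surrounding $q$. Inverses of these moves are also allowed. Writhe polynomial. Let $G$ be a Gauss diagram (one circle) of an oriented virtual knot $K$. For a chord $\gamma$, the index ${\rm Ind}(\gamma)\in\mathbb{Z}$ is the sum of the signs of the endpoints of chords lying on the open arc of the circle that runs, along the orientation, from the initial endpoint of $\gamma$ to the terminal endpoint of $\gamma$. For $n\neq 0$, $J_n(K)$ is the sum of the signs of all chords $\gamma$ of $G$ with ${\rm Ind}(\gamma)=n$; it is independent of the choice of $G$ for $K$. The writhe polynomial is $W_K(t)=\sum_{n\ne 0}J_n(K)t^n-\sum_{n\ne 0}J_n(K)\in\mathbb{Z}[t,t^{-1}]$. *)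

theory Defs
  imports "HOL-Library.Poly_Mapping"
begin

section \<open>Gauss diagrams with one circle\<close>

text \<open>
  A chord is a name together with a sign. The names only serve to tell chords of the same sign
  apart. A Gauss diagram is presented by the word of the chord endpoints met when running once
  along the oriented circle from some base point. Base point and names are immaterial: words that
  differ only in them are related by \<open>same_diagram\<close> below and hence represent the same virtual knot.
\<close>

type_synonym chord = "nat \<times> int"

abbreviation sign :: "chord \<Rightarrow> int" where
  "sign \<equiv> snd"

datatype 'c endpoint = Ini (chord_of: 'c) | Ter (chord_of: 'c)

fun endpoint_sign :: "chord endpoint \<Rightarrow> int" where
  "endpoint_sign (Ini \<gamma>) = - sign \<gamma>"
| "endpoint_sign (Ter \<gamma>) = sign \<gamma>"

definition chords :: "chord endpoint list \<Rightarrow> chord set" where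
  "chords w = {\<gamma>. Ini \<gamma> \<in> set w}"

definition gauss_word :: "chord endpoint list \<Rightarrow> bool" where
  "gauss_word w \<longleftrightarrow> distinct w \<and> (\<forall>\<gamma>. Ini \<gamma> \<in> set w \<longleftrightarrow> Ter \<gamma> \<in> set w)
     \<and> (\<forall>\<gamma>\<in>chords w. sign \<gamma> \<in> {1, - 1})"

typedef gauss_diagram = "{w. gauss_word w}"
  morphisms endpoints Gauss_diagram
proof
  show "[] \<in> {w. gauss_word w}" by (simp add: gauss_word_def chords_def)
qed

setup_lifting type_definition_gauss_diagram


section \<open>Moves\<close>

text \<open>
  The moves are first given as relations on words, in one direction only; the inverses are added by
  \<open>equivclp\<close>. As the base point is free, each pattern may be assumed to begin at the base point.
  The relations are only used between words of Gauss diagrams, so that the requirement that an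
  inserted chord be a new one, or that chords with distinct roles in a move be distinct, is implied
  by \<open>gauss_word\<close> holding on both sides.
\<close>

inductive same_diagram :: "chord endpoint list \<Rightarrow> chord endpoint list \<Rightarrow> bool" where
  base_point: "same_diagram (u @ v) (v @ u)"
| renaming: "inj_on f (chords w) \<Longrightarrow> (\<And>\<gamma>. \<gamma> \<in> chords w \<Longrightarrow> sign (f \<gamma>) = sign \<gamma>)
    \<Longrightarrow> same_diagram w (map (map_endpoint f) w)"

inductive reidemeister_word :: "chord endpoint list \<Rightarrow> chord endpoint list \<Rightarrow> bool" where
  R1_ini_ter: "reidemeister_word w ([Ini \<gamma>, Ter \<gamma>] @ w)"
| R1_ter_ini: "reidemeister_word w ([Ter \<gamma>, Ini \<gamma>] @ w)"
| R2_parallel: "sign b = - sign a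
    \<Longrightarrow> reidemeister_word (u @ v) ([Ini a, Ini b] @ u @ [Ter a, Ter b] @ v)"
| R2_antiparallel: "sign b = - sign a
    \<Longrightarrow> reidemeister_word (u @ v) ([Ini a, Ini b] @ u @ [Ter b, Ter a] @ v)"
  \<comment> \<open>the two rules for R3 are the two cyclic orders in which the three adjacent pairs can occur\<close>
| R3_1: "sign a = sign b \<Longrightarrow> sign b = sign c
    \<Longrightarrow> reidemeister_word
          ([Ini a, Ini b] @ u @ [Ter a, Ini c] @ v @ [Ter b, Ter c] @ w)
          ([Ini b, Ini a] @ u @ [Ini c, Ter a] @ v @ [Ter c, Ter b] @ w)"
| R3_2: "sign a = sign b \<Longrightarrow> sign b = sign c
    \<Longrightarrow> reidemeister_word
          ([Ini a, Ini b] @ u @ [Ter b, Ter c] @ v @ [Ter a, Ini c] @ w)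
          ([Ini b, Ini a] @ u @ [Ter c, Ter b] @ v @ [Ini c, Ter a] @ w)"

text \<open>The endpoint \<open>p\<close>, immediately surrounded by the shell \<open>\<sigma>\<close>:\<close>

definition shelled :: "chord \<Rightarrow> chord endpoint \<Rightarrow> chord endpoint list" where
  "shelled \<sigma> p = (if endpoint_sign p = 1 then [Ini \<sigma>, p, Ter \<sigma>] else [Ter \<sigma>, p, Ini \<sigma>])"

inductive shell_word :: "chord endpoint list \<Rightarrow> chord endpoint list \<Rightarrow> bool" where
  S1: "{p, q} = {Ini \<gamma>, Ter \<gamma>} \<Longrightarrow> sign \<sigma>' = sign \<sigma>
    \<Longrightarrow> shell_word (shelled \<sigma> p @ u @ [q] @ v) ([p] @ u @ shelled \<sigma>' q @ v)"
| S2: "chord_of p \<noteq> chord_of q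
    \<Longrightarrow> sign \<sigma> = endpoint_sign p * endpoint_sign q
    \<Longrightarrow> sign \<tau> = - (endpoint_sign p * endpoint_sign q)
    \<Longrightarrow> shell_word ([p, q] @ u) (shelled \<tau> q @ shelled \<sigma> p @ u)"

lift_definition reidemeister_move :: "gauss_diagram \<Rightarrow> gauss_diagram \<Rightarrow> bool" is
  "\<lambda>w w'. same_diagram w w' \<or> reidemeister_word w w'" .

lift_definition shell_move :: "gauss_diagram \<Rightarrow> gauss_diagram \<Rightarrow> bool" is shell_word .

definition reidemeister_equiv :: "gauss_diagram \<Rightarrow> gauss_diagram \<Rightarrow> bool" where
  "reidemeister_equiv = equivclp reidemeister_move"

definition shell_equiv :: "gauss_diagram \<Rightarrow> gauss_diagram \<Rightarrow> bool" where
  "shell_equiv = equivclp (\<lambda>G G'. reidemeister_move G G' \<or> shell_move G G')"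


section \<open>Oriented virtual knots\<close>

quotient_type virtual_knot = gauss_diagram / reidemeister_equiv
  morphisms rep_virtual_knot virtual_knot_of
  unfolding reidemeister_equiv_def by (rule equivp_evquivclp)

definition shell_related :: "virtual_knot \<Rightarrow> virtual_knot \<Rightarrow> bool" where
  "shell_related K K' \<longleftrightarrow>
     (\<exists>G G'. virtual_knot_of G = K \<and> virtual_knot_of G' = K' \<and> shell_equiv G G')"

lemma reidemeister_equiv_imp_shell_equiv:
  "reidemeister_equiv G G' \<Longrightarrow> shell_equiv G G'"
  unfolding reidemeister_equiv_def shell_equiv_def
  by (induction rule: equivclp_induct) (auto intro: equivclp_into_equivclp)

lemma shell_related_iff_any_diagrams:
  "shell_related K K' \<longleftrightarrow>
     (\<forall>G G'. virtual_knot_of G = K \<longrightarrow> virtual_knot_of G' = K' \<longrightarrow> shell_equiv G G')"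
proof
  have trans: "shell_equiv F H" if "shell_equiv F G" "shell_equiv G H" for F G H
    using that unfolding shell_equiv_def by (rule equivclp_trans)
  have same: "shell_equiv F G" if "virtual_knot_of F = virtual_knot_of G" for F G
    using that by (simp add: virtual_knot.abs_eq_iff reidemeister_equiv_imp_shell_equiv)
  show "\<forall>G G'. virtual_knot_of G = K \<longrightarrow> virtual_knot_of G' = K' \<longrightarrow> shell_equiv G G'"
    if "shell_related K K'"
    using that unfolding shell_related_def by (metis trans same)
next
  show "shell_related K K'"
    if "\<forall>G G'. virtual_knot_of G = K \<longrightarrow> virtual_knot_of G' = K' \<longrightarrow> shell_equiv G G'"
    using that unfolding shell_related_def
    by (metis Quotient3_virtual_knot Quotient3_abs_rep)
qed


section \<open>The writhe polynomial\<close>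

text \<open>
  For \<open>p\<close> and \<open>q\<close> in \<open>w\<close>, the endpoints on the open arc running from \<open>p\<close> to \<open>q\<close>: the base point is
  moved to \<open>p\<close>, and what lies strictly between \<open>p\<close> and \<open>q\<close> is kept.
\<close>

definition open_arc :: "'a \<Rightarrow> 'a \<Rightarrow> 'a list \<Rightarrow> 'a list" where
  "open_arc p q w = takeWhile (\<lambda>x. x \<noteq> q)
     (tl (dropWhile (\<lambda>x. x \<noteq> p) w @ takeWhile (\<lambda>x. x \<noteq> p) w))"

definition index :: "chord endpoint list \<Rightarrow> chord \<Rightarrow> int" where
  "index w \<gamma> = (\<Sum>p\<leftarrow>open_arc (Ini \<gamma>) (Ter \<gamma>) w. endpoint_sign p)"

definition writhe :: "chord endpoint list \<Rightarrow> int \<Rightarrow> int" where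
  "writhe w n = (\<Sum>\<gamma>\<in>{\<gamma>\<in>chords w. index w \<gamma> = n}. sign \<gamma>)"

text \<open>
  Laurent polynomials with integer coefficients are finitely supported functions on the exponents,
  that is, \<open>Poly_Mapping.single n a\<close> is the monomial with exponent \<open>n\<close> and coefficient \<open>a\<close>.
\<close>

type_synonym laurent_poly = "int \<Rightarrow>\<^sub>0 int"

definition writhe_poly_word :: "chord endpoint list \<Rightarrow> laurent_poly" where
  "writhe_poly_word w =
     (\<Sum>n\<in>{n. n \<noteq> 0 \<and> writhe w n \<noteq> 0}. Poly_Mapping.single n (writhe w n))
     - Poly_Mapping.single 0 (\<Sum>n\<in>{n. n \<noteq> 0 \<and> writhe w n \<noteq> 0}. writhe w n)"

lemma finite_chords [simp]: "finite (chords w)"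
proof -
  have "chords w \<subseteq> chord_of ` set w"
    unfolding chords_def by force
  then show ?thesis by (rule finite_subset) simp
qed

lemma finite_writhe_support: "finite {n. n \<noteq> 0 \<and> writhe w n \<noteq> 0}"
proof -
  have "n \<in> index w ` chords w" if "writhe w n \<noteq> 0" for n
    using that unfolding writhe_def by (metis (mono_tags, lifting) empty_Collect_eq imageI sum.empty)
  then have "{n. n \<noteq> 0 \<and> writhe w n \<noteq> 0} \<subseteq> index w ` chords w" by blast
  then show ?thesis by (rule finite_subset) simp
qed


subsection \<open>Invariance under the Reidemeister moves\<close>

text \<open>
  The sum of the signs of the endpoints that precede \<open>x\<close> in a word. As the signs of all endpoints
  add up to zero, an index is a difference of such sums up to a correction term.
\<close>

fun prefix_sum :: "chord endpoint list \<Rightarrow> chord endpoint \<Rightarrow> int" where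
  "prefix_sum [] x = 0"
| "prefix_sum (y # ys) x = (if x = y then 0 else endpoint_sign y + prefix_sum ys x)"

abbreviation total :: "chord endpoint list \<Rightarrow> int" where
  "total w \<equiv> sum_list (map endpoint_sign w)"

lemma prefix_sum_append:
  "prefix_sum (u @ v) x = (if x \<in> set u then prefix_sum u x else total u + prefix_sum v x)"
  by (induction u) auto

lemma prefix_sum_notin: "x \<notin> set w \<Longrightarrow> prefix_sum w x = total w"
  by (induction w) auto

lemma gauss_word_memD:
  assumes "gauss_word w" "\<gamma> \<in> chords w"
  shows "Ini \<gamma> \<in> set w" "Ter \<gamma> \<in> set w"
  using assms unfolding gauss_word_def chords_def by blast+

lemma gauss_word_set:
  assumes "gauss_word w"
  shows "set w = Ini ` chords w \<union> Ter ` chords w"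
proof (rule set_eqI)
  fix x show "x \<in> set w \<longleftrightarrow> x \<in> Ini ` chords w \<union> Ter ` chords w"
    using assms by (cases x) (auto simp: gauss_word_def chords_def)
qed

lemma total_gauss_word:
  assumes "gauss_word w"
  shows "total w = 0"
proof -
  have "total w = (\<Sum>x\<in>set w. endpoint_sign x)"
    using assms by (simp add: gauss_word_def sum_list_distinct_conv_sum_set)
  also have "\<dots> = (\<Sum>x\<in>Ini ` chords w. endpoint_sign x) + (\<Sum>x\<in>Ter ` chords w. endpoint_sign x)"
    unfolding gauss_word_set[OF assms] by (rule sum.union_disjoint) auto
  also have "\<dots> = 0"
    by (simp add: sum.reindex inj_on_def sum_negf)
  finally show ?thesis .
qed

lemma index_eq_prefix_sum:
  assumes "gauss_word w" "\<gamma> \<in> chords w"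
  shows "index w \<gamma> = prefix_sum w (Ter \<gamma>) - prefix_sum w (Ini \<gamma>) + sign \<gamma>"
proof -
  have d: "distinct w" using assms by (simp add: gauss_word_def)
  note mem = gauss_word_memD[OF assms]
  obtain u v where w: "w = u @ Ini \<gamma> # v"
    using mem(1) by (meson split_list)
  have notin: "Ini \<gamma> \<notin> set u" "Ini \<gamma> \<notin> set v"
    using d w by auto
  have rot: "dropWhile (\<lambda>x. x \<noteq> Ini \<gamma>) w = Ini \<gamma> # v" "takeWhile (\<lambda>x. x \<noteq> Ini \<gamma>) w = u"
    unfolding w using notin by (subst dropWhile_append2 takeWhile_append2; auto)+
  have ix: "index w \<gamma> = total (takeWhile (\<lambda>x. x \<noteq> Ter \<gamma>) (v @ u))"
    by (simp add: index_def open_arc_def rot)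
  have tw: "total (takeWhile (\<lambda>x. x \<noteq> y) z) = prefix_sum z y" for y z
    by (induction z) auto
  have tot: "total u - sign \<gamma> + total v = 0"
    using total_gauss_word[OF assms(1)] by (simp add: w)
  show ?thesis
  proof (cases "Ter \<gamma> \<in> set u")
    case True
    then have "Ter \<gamma> \<notin> set v" using d w by auto
    then show ?thesis using True notin tot
      unfolding ix tw by (simp add: w prefix_sum_append)
  next
    case False
    then have "Ter \<gamma> \<in> set v" using mem w by auto
    then show ?thesis using False notin
      unfolding ix tw by (simp add: w prefix_sum_append)
  qed
qed

lemma writhe_eq:
  "writhe w n = (\<Sum>\<gamma>\<in>chords w. if index w \<gamma> = n then sign \<gamma> else 0)"
  unfolding writhe_def by (subst sum.inter_filter[symmetric]) auto

lemma writhe_same_chords: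
  assumes "chords w' = chords w" "\<And>\<gamma>. \<gamma> \<in> chords w \<Longrightarrow> index w' \<gamma> = index w \<gamma>"
  shows "writhe w' n = writhe w n"
  unfolding writhe_eq assms(1) by (rule sum.cong) (simp_all add: assms(2))

lemma writhe_same_diagram:
  assumes "same_diagram w w'" "gauss_word w" "gauss_word w'"
  shows "writhe w' n = writhe w n"
  using assms
proof (cases rule: same_diagram.cases)
  case (base_point u v)
  have ch: "chords w' = chords w"
    by (auto simp: base_point chords_def)
  have "total u + total v = 0"
    using total_gauss_word[OF assms(2)] by (simp add: base_point)
  moreover have "set u \<inter> set v = {}"
    using assms(2) by (auto simp: base_point gauss_word_def)
  ultimately have shift: "prefix_sum w' x = prefix_sum w x - total u" if "x \<in> set w" for x
    using that by (auto simp: base_point prefix_sum_append)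
  show ?thesis
  proof (rule writhe_same_chords[OF ch])
    fix \<gamma> assume g: "\<gamma> \<in> chords w"
    then have "Ini \<gamma> \<in> set w" "Ter \<gamma> \<in> set w"
      using assms(2) gauss_word_memD by auto
    then show "index w' \<gamma> = index w \<gamma>"
      using g ch assms(2,3) by (simp add: index_eq_prefix_sum shift)
  qed
next
  case (renaming f)
  have chords_in: "chord_of x \<in> chords w" if "x \<in> set w" for x
    using that gauss_word_set[OF assms(2)] by auto
  have ch: "chords w' = f ` chords w"
  proof (rule set_eqI)
    fix \<gamma>
    have "\<gamma> \<in> chords w' \<longleftrightarrow> (\<exists>x\<in>set w. Ini \<gamma> = map_endpoint f x)"
      by (auto simp: renaming(1) chords_def)
    also have "\<dots> \<longleftrightarrow> (\<exists>\<delta>. Ini \<delta> \<in> set w \<and> \<gamma> = f \<delta>)"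
      by (metis endpoint.exhaust endpoint.inject(1) endpoint.distinct(1) endpoint.map)
    finally show "\<gamma> \<in> chords w' \<longleftrightarrow> \<gamma> \<in> f ` chords w"
      by (auto simp: chords_def)
  qed
  have pre: "prefix_sum (map (map_endpoint f) z) (map_endpoint f x) = prefix_sum z x"
    if "chord_of ` set z \<subseteq> chords w" "chord_of x \<in> chords w" for z x
    using that
  proof (induction z)
    case (Cons y z)
    have "map_endpoint f x = map_endpoint f y \<longleftrightarrow> x = y"
      using Cons.prems renaming(2) by (cases x; cases y) (auto simp: inj_on_def)
    moreover have "endpoint_sign (map_endpoint f y) = endpoint_sign y"
      using Cons.prems renaming(3) by (cases y) auto
    ultimately show ?case using Cons by auto
  qed simp
  have ix: "index w' (f \<gamma>) = index w \<gamma>" if "\<gamma> \<in> chords w" for \<gamma>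
  proof -
    have sub: "chord_of ` set w \<subseteq> chords w" using chords_in by auto
    have "f \<gamma> \<in> chords w'" using that ch by auto
    then show ?thesis
      using that pre[OF sub, of "Ini \<gamma>"] pre[OF sub, of "Ter \<gamma>"] renaming(3)[OF that]
      by (simp add: index_eq_prefix_sum assms renaming(1)[symmetric])
  qed
  show ?thesis
    unfolding writhe_eq ch sum.reindex[OF renaming(2)] o_def
    by (rule sum.cong) (simp_all add: ix renaming(3))
qed

lemma writhe_insert:
  assumes "chords w' = A \<union> chords w" "A \<inter> chords w = {}" "finite A"
    and "\<And>\<gamma>. \<gamma> \<in> chords w \<Longrightarrow> index w' \<gamma> = index w \<gamma>"
    and "(\<Sum>\<gamma>\<in>A. if index w' \<gamma> = n then sign \<gamma> else 0) = 0"
  shows "writhe w' n = writhe w n"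
  unfolding writhe_eq assms(1) using assms(2-5) by (simp add: sum.union_disjoint)

lemma writhe_reidemeister_word:
  assumes "reidemeister_word w w'" "gauss_word w" "gauss_word w'" "n \<noteq> 0"
  shows "writhe w' n = writhe w n"
proof -
  have ixw: "index w \<gamma> = prefix_sum w (Ter \<gamma>) - prefix_sum w (Ini \<gamma>) + sign \<gamma>"
    if "\<gamma> \<in> chords w" for \<gamma>
    using that assms index_eq_prefix_sum by blast
  have ixw': "index w' \<gamma> = prefix_sum w' (Ter \<gamma>) - prefix_sum w' (Ini \<gamma>) + sign \<gamma>"
    if "\<gamma> \<in> chords w'" for \<gamma>
    using that assms index_eq_prefix_sum by blast
  have d: "distinct w" "distinct w'" using assms by (auto simp: gauss_word_def)
  show ?thesis using assms(1)
  proof (cases rule: reidemeister_word.cases)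
    case (R1_ini_ter \<gamma>)
    show ?thesis
    proof (rule writhe_insert[where A = "{\<gamma>}"])
      show ch: "chords w' = {\<gamma>} \<union> chords w"
        by (auto simp: R1_ini_ter chords_def)
      show new: "{\<gamma>} \<inter> chords w = {}"
        using d by (auto simp: R1_ini_ter chords_def)
      show "index w' \<delta> = index w \<delta>" if "\<delta> \<in> chords w" for \<delta>
        using that ch new by (subst ixw ixw'; auto simp: R1_ini_ter)+
      show "(\<Sum>\<gamma>\<in>{\<gamma>}. if index w' \<gamma> = n then sign \<gamma> else 0) = 0"
      proof -
        have mem: "\<gamma> \<in> chords w'" using ch by simp
        have "index w' \<gamma> = 0" unfolding ixw'[OF mem] by (simp add: R1_ini_ter)
        then show ?thesis using assms(4) by simp
      qed
    qed simp
  next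
    case (R1_ter_ini \<gamma>)
    show ?thesis
    proof (rule writhe_insert[where A = "{\<gamma>}"])
      show ch: "chords w' = {\<gamma>} \<union> chords w"
        by (auto simp: R1_ter_ini chords_def)
      show new: "{\<gamma>} \<inter> chords w = {}"
        using d by (auto simp: R1_ter_ini chords_def)
      show "index w' \<delta> = index w \<delta>" if "\<delta> \<in> chords w" for \<delta>
        using that ch new by (subst ixw ixw'; auto simp: R1_ter_ini)+
      show "(\<Sum>\<gamma>\<in>{\<gamma>}. if index w' \<gamma> = n then sign \<gamma> else 0) = 0"
      proof -
        have mem: "\<gamma> \<in> chords w'" using ch by simp
        have "index w' \<gamma> = 0" unfolding ixw'[OF mem] by (simp add: R1_ter_ini)
        then show ?thesis using assms(4) by simp
      qed
    qed simp
  next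
    case (R2_parallel b a u v)
    have ab: "a \<noteq> b" using d by (auto simp: R2_parallel)
    show ?thesis
    proof (rule writhe_insert[where A = "{a, b}"])
      show ch: "chords w' = {a, b} \<union> chords w"
        by (auto simp: R2_parallel chords_def)
      show new: "{a, b} \<inter> chords w = {}"
        using d by (auto simp: R2_parallel chords_def)
      show "index w' \<delta> = index w \<delta>" if "\<delta> \<in> chords w" for \<delta>
      proof -
        have "\<delta> \<noteq> a" "\<delta> \<noteq> b" and mem: "\<delta> \<in> chords w'" using that ch new by auto
        then show ?thesis
          using R2_parallel(3) unfolding ixw[OF that] ixw'[OF mem]
          by (simp add: R2_parallel(1,2) prefix_sum_append)
      qed
      have mem: "a \<in> chords w'" "b \<in> chords w'" using ch by auto
      have "index w' a = index w' b"
        using ab R2_parallel(3) d unfolding ixw'[OF mem(1)] ixw'[OF mem(2)]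
        by (simp add: R2_parallel(1,2) prefix_sum_append)
      then show "(\<Sum>\<gamma>\<in>{a, b}. if index w' \<gamma> = n then sign \<gamma> else 0) = 0"
        using ab R2_parallel(3) by simp
    qed simp
  next
    case (R2_antiparallel b a u v)
    have ab: "a \<noteq> b" using d by (auto simp: R2_antiparallel)
    show ?thesis
    proof (rule writhe_insert[where A = "{a, b}"])
      show ch: "chords w' = {a, b} \<union> chords w"
        by (auto simp: R2_antiparallel chords_def)
      show new: "{a, b} \<inter> chords w = {}"
        using d by (auto simp: R2_antiparallel chords_def)
      show "index w' \<delta> = index w \<delta>" if "\<delta> \<in> chords w" for \<delta>
      proof -
        have "\<delta> \<noteq> a" "\<delta> \<noteq> b" and mem: "\<delta> \<in> chords w'" using that ch new by auto
        then show ?thesis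
          using R2_antiparallel(3) unfolding ixw[OF that] ixw'[OF mem]
          by (simp add: R2_antiparallel(1,2) prefix_sum_append)
      qed
      have mem: "a \<in> chords w'" "b \<in> chords w'" using ch by auto
      have "index w' a = index w' b"
        using ab R2_antiparallel(3) d unfolding ixw'[OF mem(1)] ixw'[OF mem(2)]
        by (simp add: R2_antiparallel(1,2) prefix_sum_append)
      then show "(\<Sum>\<gamma>\<in>{a, b}. if index w' \<gamma> = n then sign \<gamma> else 0) = 0"
        using ab R2_antiparallel(3) by simp
    qed simp
  next
    case (R3_1 a b c u v z)
    have ch: "chords w' = chords w"
      by (auto simp: R3_1 chords_def)
    show ?thesis
    proof (rule writhe_same_chords[OF ch])
      fix \<delta> assume g: "\<delta> \<in> chords w"
      then have g': "\<delta> \<in> chords w'" by (simp add: ch)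
      show "index w' \<delta> = index w \<delta>"
        using d R3_1(3,4) unfolding ixw[OF g] ixw'[OF g']
        by (auto simp: R3_1(1,2) prefix_sum_append)
    qed
  next
    case (R3_2 a b c u v z)
    have ch: "chords w' = chords w"
      by (auto simp: R3_2 chords_def)
    show ?thesis
    proof (rule writhe_same_chords[OF ch])
      fix \<delta> assume g: "\<delta> \<in> chords w"
      then have g': "\<delta> \<in> chords w'" by (simp add: ch)
      show "index w' \<delta> = index w \<delta>"
        using d R3_2(3,4) unfolding ixw[OF g] ixw'[OF g']
        by (auto simp: R3_2(1,2) prefix_sum_append)
    qed
  qed
qed

lemma writhe_poly_word_cong:
  assumes "\<And>n. n \<noteq> 0 \<Longrightarrow> writhe w' n = writhe w n"
  shows "writhe_poly_word w' = writhe_poly_word w"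
proof -
  have "{n. n \<noteq> 0 \<and> writhe w' n \<noteq> 0} = {n. n \<noteq> 0 \<and> writhe w n \<noteq> 0}"
    using assms by auto
  then show ?thesis
    unfolding writhe_poly_word_def using assms by simp
qed

lift_definition writhe_poly_diagram :: "gauss_diagram \<Rightarrow> laurent_poly" is writhe_poly_word .

lemma writhe_poly_diagram_move:
  "reidemeister_move G G' \<Longrightarrow> writhe_poly_diagram G' = writhe_poly_diagram G"
  by transfer
    (auto intro!: writhe_poly_word_cong dest: writhe_same_diagram writhe_reidemeister_word)

lift_definition writhe_poly :: "virtual_knot \<Rightarrow> laurent_poly" is writhe_poly_diagram
proof -
  show "writhe_poly_diagram G = writhe_poly_diagram G'" if "reidemeister_equiv G G'" for G G'
    using that unfolding reidemeister_equiv_def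
    by (induction rule: equivclp_induct) (auto dest: writhe_poly_diagram_move)
qed

end

theory Submission
  imports Defs "HOL-Library.Countable" "HOL-Library.Multiset"
begin

text \<open>
  Shells have index one and enter a diagram in pairs of opposite signs or trade places, so the shell
  moves preserve the writhe polynomial.

  Conversely, view a diagram as a base word together with shells around its endpoints. By S1 and R2,
  only the total sign of the shells of each chord matters, hence only the index that the chord has
  in the whole diagram. The move S2 then allows adjacent endpoints of different chords to be swapped
  while all these indices are kept. Endpoints of the same chord are swapped by moving one of them
  around the circle. So, up to shell moves, a diagram is a finite set of signed chords with indices.
  A chord of index 0 can be drawn so that R1 removes it, one of index 1 so that it is a shell, and
  two chords of opposite signs and the same index so that R2 removes them. What is left is
  determined by the coefficients of the writhe polynomial.
\<close>

text \<open>What makes shells manageable is that their effect is additive and local. The endpoint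
  signs of a shell cancel, so it changes the index of no chord but the one it surrounds; a shell of
  sign s lowers the index of \<gamma> by \<open>sign \<gamma> * s\<close>, at either endpoint. The
  step being 1 or -1, every prescribed integer index can be reached by adding shells. This is why
  the base word may vary freely while an index function \<open>i\<close> is held fixed, and why all
  later comparisons are made relative to such an \<open>i\<close>.

  Two obstacles shape the rest. First, names identify chords across words: relative to one
  \<open>i\<close>, a chord occurring in two words must have the same index in both, so two
  unrelated diagrams can only be compared through freshly named copies. Second, chords cannot simply
  be cancelled inside a word, since the drawing that makes R1, R2 or a shell visible may need
  endpoints that the word lacks. Words are therefore compared by enlarging them, with auxiliary
  chords or up to a common larger word. Chords of index 1 can be created at will as shells, so only
  the coefficients at exponents other than 0 and 1 are compared in the end.\<close>

declare split_paired_All [simp del] split_paired_Ex [simp del]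

section \<open>Invariance of the writhe polynomial\<close>

lemma endpoint_sign_cases:
  assumes "gauss_word w" "p \<in> set w"
  shows "endpoint_sign p = 1 \<or> endpoint_sign p = - 1"
  using gauss_word_set[OF assms(1)] assms by (auto simp: gauss_word_def)

lemma gauss_word_cong_mset:
  assumes "gauss_word w" "mset w = mset w'"
  shows "gauss_word w'"
  using assms mset_eq_imp_distinct_iff[OF assms(2)] mset_eq_setD[OF assms(2)]
  by (simp add: gauss_word_def chords_def)

lemma chords_append [simp]: "chords (u @ v) = chords u \<union> chords v"
  by (auto simp: chords_def)

lemma chords_Nil [simp]: "chords [] = {}"
  by (auto simp: chords_def)

lemma chords_Cons [simp]: "chords (p # w) = (case p of Ini \<gamma> \<Rightarrow> {\<gamma>} | Ter \<gamma> \<Rightarrow> {}) \<union> chords w"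
  by (auto simp: chords_def split: endpoint.splits)

lemma chord_of_in_chords: "gauss_word w \<Longrightarrow> p \<in> set w \<Longrightarrow> chord_of p \<in> chords w"
  using gauss_word_set by fastforce

lemma gauss_word_add_chord:
  assumes "gauss_word w" "\<gamma> \<notin> chords w" "sign \<gamma> \<in> {1, - 1}"
  shows "gauss_word ([Ini \<gamma>, Ter \<gamma>] @ w)"
proof -
  have "Ini \<gamma> \<notin> set w" "Ter \<gamma> \<notin> set w"
    using assms gauss_word_set[OF assms(1)] by auto
  then show ?thesis using assms by (auto simp: gauss_word_def simp del: split_paired_All)
qed

text \<open>Supplies a word for a set of chords. Which word is obtained is immaterial later, by
  \<open>ind_equiv_same_chords\<close>.\<close>

lemma gauss_word_exists:
  assumes "finite C" "\<And>\<gamma>. \<gamma> \<in> C \<Longrightarrow> sign \<gamma> \<in> {1, - 1}"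
  shows "\<exists>w. gauss_word w \<and> chords w = C"
  using assms
proof (induction C)
  case empty
  then show ?case by (intro exI[of _ "[]"]) (simp add: gauss_word_def)
next
  case (insert \<gamma> C)
  then obtain w where "gauss_word w" "chords w = C" by auto
  then show ?case using insert gauss_word_add_chord[of w \<gamma>]
    by (intro exI[of _ "[Ini \<gamma>, Ter \<gamma>] @ w"]) simp
qed

text \<open>The orientation rule for shells makes both cases agree. Around a positive
  \<open>p\<close> the arc of \<sigma> contains only \<open>p\<close>; around a negative
  \<open>p\<close> it contains everything except \<open>p\<close> and the endpoints of \<sigma>, and
  the signs of all endpoints add up to zero.\<close>

lemma index_shell:
  assumes "gauss_word (A @ shelled \<sigma> p @ B)"
  shows "index (A @ shelled \<sigma> p @ B) \<sigma> = 1"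
proof -
  have "distinct (A @ shelled \<sigma> p @ B)" using assms by (simp add: gauss_word_def)
  then have n: "Ini \<sigma> \<notin> set A" "Ter \<sigma> \<notin> set A" "p \<noteq> Ini \<sigma>" "p \<noteq> Ter \<sigma>"
    by (auto simp: shelled_def split: if_splits)
  have sp: "endpoint_sign p = 1 \<or> endpoint_sign p = - 1"
    using endpoint_sign_cases[OF assms] by (auto simp: shelled_def)
  have "\<sigma> \<in> chords (A @ shelled \<sigma> p @ B)"
    by (auto simp: shelled_def chords_def)
  then show ?thesis
    using n sp by (subst index_eq_prefix_sum[OF assms]) (auto simp: shelled_def prefix_sum_append)
qed

section \<open>Effect of the shell moves on indices and writhes\<close>

lemma writhe_shell_word:
  assumes "shell_word w w'" "gauss_word w" "gauss_word w'" "n \<noteq> 0"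
  shows "writhe w' n = writhe w n"
proof -
  have ixw: "index w \<gamma> = prefix_sum w (Ter \<gamma>) - prefix_sum w (Ini \<gamma>) + sign \<gamma>"
    if "\<gamma> \<in> chords w" for \<gamma>
    using that assms index_eq_prefix_sum by blast
  have ixw': "index w' \<gamma> = prefix_sum w' (Ter \<gamma>) - prefix_sum w' (Ini \<gamma>) + sign \<gamma>"
    if "\<gamma> \<in> chords w'" for \<gamma>
    using that assms index_eq_prefix_sum by blast
  have d: "distinct w" "distinct w'" using assms by (auto simp: gauss_word_def)
  show ?thesis using assms(1)
  proof (cases rule: shell_word.cases)
    case (S1 p q \<gamma> \<sigma>' \<sigma> u v)
    have pq: "p = Ini \<gamma> \<and> q = Ter \<gamma> \<or> p = Ter \<gamma> \<and> q = Ini \<gamma>"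
      using S1(3) by (auto simp: doubleton_eq_iff)
    have sp: "endpoint_sign p = 1 \<or> endpoint_sign p = - 1" "endpoint_sign q = 1 \<or> endpoint_sign q = - 1"
      using endpoint_sign_cases[OF assms(3)] by (auto simp: S1 shelled_def)
    define C where "C = chords ([p, q] @ u @ v)"
    have ch: "chords w = insert \<sigma> C" "chords w' = insert \<sigma>' C"
      by (auto simp: S1(1,2) C_def shelled_def split: endpoint.splits)
    have new: "\<sigma> \<notin> C" "\<sigma>' \<notin> C"
      using d by (auto simp: S1(1,2) C_def shelled_def chords_def split: if_splits)
    have "index w \<sigma> = 1" "index w' \<sigma>' = 1"
      using index_shell[of "[]" \<sigma> p "u @ [q] @ v"] index_shell[of "[p] @ u" \<sigma>' q v] assms(2,3)
      by (simp_all add: S1(1,2))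
    moreover have "index w' \<delta> = index w \<delta>" if "\<delta> \<in> C" for \<delta>
    proof -
      have g: "\<delta> \<in> chords w" "\<delta> \<in> chords w'" "\<delta> \<noteq> \<sigma>" "\<delta> \<noteq> \<sigma>'" using that ch new by auto
      have dpq: "p \<noteq> q" "p \<notin> set u" "q \<notin> set u"
        using d(1) by (auto simp: S1(1) shelled_def split: if_splits)
      \<comment> \<open>Only the surrounded endpoint has one endpoint of the shell before it and the
        other behind it. The one before \<open>p\<close> has sign
        \<open>- (endpoint_sign p * sign \<sigma>)\<close> in both orientations.\<close>
      have shift: "prefix_sum w' x = prefix_sum w x - (if x = q then endpoint_sign q * sign \<sigma> else 0)
          + (if x = p then endpoint_sign p * sign \<sigma> else 0)"
        if "x \<notin> {Ini \<sigma>, Ter \<sigma>, Ini \<sigma>', Ter \<sigma>'}" for x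
      proof -
        consider "x = p" | "x = q" | "x \<noteq> p" "x \<noteq> q" by blast
        then show ?thesis
          using that sp dpq S1(4)
          by cases (auto simp: S1(1,2) shelled_def prefix_sum_append)
      qed
      \<comment> \<open>For \<gamma> the two corrections are equal and drop out of the difference:
        one endpoint loses the shell, the other gains it, and their signs are opposite.\<close>
      have "prefix_sum w' (Ter \<delta>) - prefix_sum w' (Ini \<delta>) = prefix_sum w (Ter \<delta>) - prefix_sum w (Ini \<delta>)"
        using pq g(3,4) by (cases "\<delta> = \<gamma>") (auto simp: shift)
      then show ?thesis
        unfolding ixw[OF g(1)] ixw'[OF g(2)] by simp
    qed
    moreover have "finite C" by (simp add: C_def del: chords_append chords_Cons)
    moreover have "(\<Sum>\<gamma>\<in>C. if index w' \<gamma> = n then sign \<gamma> else 0) = (\<Sum>\<gamma>\<in>C. if index w \<gamma> = n then sign \<gamma> else 0)"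
      by (rule sum.cong) (simp_all add: calculation)
    ultimately show ?thesis
      unfolding writhe_eq ch using new S1(4) by simp
  next
    case (S2 p q \<sigma> \<tau> u)
    have sp: "endpoint_sign p = 1 \<or> endpoint_sign p = - 1" "endpoint_sign q = 1 \<or> endpoint_sign q = - 1"
      using endpoint_sign_cases[OF assms(2)] by (auto simp: S2)
    have st: "\<sigma> \<noteq> \<tau>" using d by (auto simp: S2 shelled_def split: if_splits)
    show ?thesis
    proof (rule writhe_insert[where A = "{\<sigma>, \<tau>}"])
      show ch: "chords w' = {\<sigma>, \<tau>} \<union> chords w"
        by (auto simp: S2 shelled_def split: endpoint.splits)
      show new: "{\<sigma>, \<tau>} \<inter> chords w = {}"
        using d by (auto simp: S2 chords_def shelled_def split: if_splits)
      show "index w' \<delta> = index w \<delta>" if "\<delta> \<in> chords w" for \<delta>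
      proof -
        have g: "\<delta> \<noteq> \<sigma>" "\<delta> \<noteq> \<tau>" and mem: "\<delta> \<in> chords w'" using that ch new by auto
        have pq: "p \<noteq> q" using S2(3) by auto
        \<comment> \<open>The signs of the new shells are made for this: the exchange adds
          \<open>endpoint_sign q\<close> before \<open>p\<close>, and \<sigma> adds
          \<open>- (endpoint_sign p * sign \<sigma>)\<close>, which is its negative. For
          \<open>q\<close> and \<tau> the same happens with opposite signs.\<close>
        have shift: "prefix_sum w' x = prefix_sum w x"
          if "x \<notin> {Ini \<sigma>, Ter \<sigma>, Ini \<tau>, Ter \<tau>}" for x
        proof -
          consider "x = p" | "x = q" | "x \<noteq> p" "x \<noteq> q" by blast
          then show ?thesis
            using that sp pq by cases (auto simp: S2(1,2,4,5) shelled_def)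
        qed
        show ?thesis
          using g unfolding ixw[OF that] ixw'[OF mem] by (simp add: shift)
      qed
      have "index w' \<tau> = 1" "index w' \<sigma> = 1"
        using index_shell[of "[]" \<tau> q "shelled \<sigma> p @ u"] index_shell[of "shelled \<tau> q" \<sigma> p u] assms(3)
        by (simp_all add: S2(2))
      then show "(\<Sum>\<gamma>\<in>{\<sigma>, \<tau>}. if index w' \<gamma> = n then sign \<gamma> else 0) = 0"
        using st S2(4,5) by simp
    qed simp
  qed
qed

lemma writhe_poly_diagram_shell_move:
  "shell_move G G' \<Longrightarrow> writhe_poly_diagram G' = writhe_poly_diagram G"
  by transfer (auto intro!: writhe_poly_word_cong dest: writhe_shell_word)

lemma writhe_poly_diagram_shell_equiv:
  "shell_equiv G G' \<Longrightarrow> writhe_poly_diagram G = writhe_poly_diagram G'"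
  unfolding shell_equiv_def
  by (induction rule: equivclp_induct)
    (auto dest: writhe_poly_diagram_move writhe_poly_diagram_shell_move)

lemma lookup_writhe_poly_word:
  assumes "n \<noteq> 0"
  shows "Poly_Mapping.lookup (writhe_poly_word w) n = writhe w n"
proof -
  have "Poly_Mapping.lookup (writhe_poly_word w) n
      = (\<Sum>m\<in>{m. m \<noteq> 0 \<and> writhe w m \<noteq> 0}. if m = n then writhe w m else 0)"
    using assms
    by (simp add: writhe_poly_word_def lookup_minus lookup_sum lookup_single when_def)
  then show ?thesis
    using assms by (simp add: sum.delta[OF finite_writhe_support])
qed

section \<open>Words with shells\<close>

definition word_equiv :: "chord endpoint list \<Rightarrow> chord endpoint list \<Rightarrow> bool" where
  "word_equiv w w' \<longleftrightarrow> gauss_word w \<and> gauss_word w' \<and>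
     shell_equiv (Gauss_diagram w) (Gauss_diagram w')"

lemma word_equiv_refl: "gauss_word w \<Longrightarrow> word_equiv w w"
  by (simp add: word_equiv_def shell_equiv_def)

lemma word_equiv_sym: "word_equiv w w' \<Longrightarrow> word_equiv w' w"
  by (auto simp: word_equiv_def shell_equiv_def intro: equivclp_sym)

lemma word_equiv_trans [trans]: "word_equiv w w' \<Longrightarrow> word_equiv w' w'' \<Longrightarrow> word_equiv w w''"
  by (auto simp: word_equiv_def shell_equiv_def intro: equivclp_trans)

text \<open>Carries a move given at the base point to any other place: both words are rotated and
  the move is applied to the rotated words.\<close>

lemma word_equiv_conj:
  "word_equiv v v' \<Longrightarrow> word_equiv w w' \<Longrightarrow> word_equiv v' w' \<Longrightarrow> word_equiv v w"
  using word_equiv_sym word_equiv_trans by blast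

lemma word_equiv_step:
  assumes "gauss_word w" "gauss_word w'" "same_diagram w w' \<or> reidemeister_word w w' \<or> shell_word w w'"
  shows "word_equiv w w'"
proof -
  have "reidemeister_move (Gauss_diagram w) (Gauss_diagram w') \<or> shell_move (Gauss_diagram w) (Gauss_diagram w')"
    using assms by (simp add: reidemeister_move.rep_eq shell_move.rep_eq Gauss_diagram_inverse)
  then show ?thesis
    unfolding word_equiv_def shell_equiv_def using assms(1,2) by blast
qed

lemma word_equiv_rotate:
  assumes "gauss_word (u @ v)"
  shows "word_equiv (u @ v) (v @ u)"
  using assms gauss_word_cong_mset[OF assms, of "v @ u"]
  by (intro word_equiv_step) (simp_all add: base_point)

text \<open>The shells are listed from the outermost to the innermost one.\<close>

definition surround :: "chord list \<Rightarrow> chord endpoint \<Rightarrow> chord endpoint list" where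
  "surround ss p = (if endpoint_sign p = 1 then map Ini ss @ [p] @ map Ter (rev ss)
     else map Ter ss @ [p] @ map Ini (rev ss))"

definition expand :: "chord endpoint list \<Rightarrow> (chord endpoint \<Rightarrow> chord list) \<Rightarrow> chord endpoint list" where
  "expand w sh = concat (map (\<lambda>p. surround (sh p) p) w)"

text \<open>These conditions make \<open>expand w sh\<close> a Gauss word. The values of
  \<open>sh\<close> outside \<open>w\<close> are arbitrary, so they have to be reset to
  \<open>[]\<close> when \<open>w\<close> is enlarged.\<close>

definition shelling :: "chord endpoint list \<Rightarrow> (chord endpoint \<Rightarrow> chord list) \<Rightarrow> bool" where
  "shelling w sh \<longleftrightarrow> gauss_word w
     \<and> (\<forall>p\<in>set w. distinct (sh p) \<and> set (sh p) \<inter> chords w = {} \<and> (\<forall>\<sigma>\<in>set (sh p). sign \<sigma> \<in> {1, - 1}))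
     \<and> (\<forall>p\<in>set w. \<forall>q\<in>set w. p \<noteq> q \<longrightarrow> set (sh p) \<inter> set (sh q) = {})"

abbreviation sign_sum :: "chord list \<Rightarrow> int" where
  "sign_sum ss \<equiv> sum_list (map sign ss)"

text \<open>Both endpoints count alike because a shell changes the index of its chord by the same
  amount at either of them.\<close>

definition shell_total :: "(chord endpoint \<Rightarrow> chord list) \<Rightarrow> chord \<Rightarrow> int" where
  "shell_total sh \<gamma> = sign_sum (sh (Ini \<gamma>)) + sign_sum (sh (Ter \<gamma>))"

lemma shelling_gauss_word: "shelling w sh \<Longrightarrow> gauss_word w"
  by (simp add: shelling_def)

lemma shellingD:
  assumes "shelling w sh" "p \<in> set w"
  shows "distinct (sh p)" "set (sh p) \<inter> chords w = {}" "\<sigma> \<in> set (sh p) \<Longrightarrow> sign \<sigma> \<in> {1, - 1}"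
  using assms unfolding shelling_def by blast+

lemma shelling_disjoint:
  assumes "shelling w sh" "p \<in> set w" "q \<in> set w" "p \<noteq> q"
  shows "set (sh p) \<inter> set (sh q) = {}"
  using assms unfolding shelling_def by blast

lemma shellingI:
  assumes "gauss_word w"
    "\<And>p. p \<in> set w \<Longrightarrow> distinct (sh p)"
    "\<And>p. p \<in> set w \<Longrightarrow> set (sh p) \<inter> chords w = {}"
    "\<And>p \<sigma>. p \<in> set w \<Longrightarrow> \<sigma> \<in> set (sh p) \<Longrightarrow> sign \<sigma> \<in> {1, - 1}"
    "\<And>p q. p \<in> set w \<Longrightarrow> q \<in> set w \<Longrightarrow> p \<noteq> q \<Longrightarrow> set (sh p) \<inter> set (sh q) = {}"
  shows "shelling w sh"
  using assms unfolding shelling_def by blast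

lemma shelling_fun_upd:
  assumes "shelling w sh" "distinct ss" "set ss \<inter> chords w = {}"
    "\<And>\<sigma>. \<sigma> \<in> set ss \<Longrightarrow> sign \<sigma> \<in> {1, - 1}"
    "\<And>q. q \<in> set w \<Longrightarrow> q \<noteq> p \<Longrightarrow> set ss \<inter> set (sh q) = {}"
  shows "shelling w (sh(p := ss))"
proof (rule shellingI)
  show "set ((sh(p := ss)) q) \<inter> set ((sh(p := ss)) r) = {}" if "q \<in> set w" "r \<in> set w" "q \<noteq> r" for q r
    using that assms(5)[of q] assms(5)[of r] shelling_disjoint[OF assms(1) that]
    by (cases "q = p"; cases "r = p") (simp_all add: Int_commute)
  show "sign \<sigma> \<in> {1, - 1}" if "q \<in> set w" "\<sigma> \<in> set ((sh(p := ss)) q)" for q \<sigma>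
    using that assms(4)[of \<sigma>] shellingD(3)[OF assms(1), of q \<sigma>] by (cases "q = p") auto
qed (use assms shellingD[OF assms(1)] shelling_gauss_word in \<open>simp_all split: if_splits\<close>)

lemma set_surround: "set (surround ss p) = {p} \<union> Ini ` set ss \<union> Ter ` set ss"
  by (auto simp: surround_def)

lemma surround_Nil [simp]: "surround [] p = [p]"
  by (simp add: surround_def)

lemma surround_single: "surround [\<sigma>] p = shelled \<sigma> p"
  by (simp add: surround_def shelled_def)

lemma expand_Nil [simp]: "expand [] sh = []"
  and expand_Cons [simp]: "expand (p # w) sh = surround (sh p) p @ expand w sh"
  and expand_append [simp]: "expand (u @ v) sh = expand u sh @ expand v sh"
  by (simp_all add: expand_def)

lemma set_expand: "set (expand w sh) = set w \<union> (\<Union>p\<in>set w. Ini ` set (sh p) \<union> Ter ` set (sh p))"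
  by (auto simp: expand_def set_surround)

lemma expand_cong: "(\<And>p. p \<in> set w \<Longrightarrow> sh p = sh' p) \<Longrightarrow> expand w sh = expand w sh'"
  by (simp add: expand_def cong: map_cong)

lemma expand_no_shells: "(\<And>p. p \<in> set w \<Longrightarrow> sh p = []) \<Longrightarrow> expand w sh = w"
  by (induction w) auto

lemma expand_fun_upd [simp]: "p \<notin> set w \<Longrightarrow> expand w (sh(p := ss)) = expand w sh"
  by (rule expand_cong) auto

lemma distinct_concat_map:
  assumes "distinct xs" "\<And>x. x \<in> set xs \<Longrightarrow> distinct (f x)"
    "\<And>x y. x \<in> set xs \<Longrightarrow> y \<in> set xs \<Longrightarrow> x \<noteq> y \<Longrightarrow> set (f x) \<inter> set (f y) = {}"
  shows "distinct (concat (map f xs))"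
  using assms
proof (induction xs)
  case (Cons x xs)
  have "set (f x) \<inter> set (f y) = {}" if "y \<in> set xs" for y
    using that Cons.prems(1) Cons.prems(3)[of x y] by auto
  then show ?case using Cons by auto
qed simp

lemma gauss_word_expand:
  assumes "shelling w sh"
  shows "gauss_word (expand w sh)"
proof -
  have g: "gauss_word w" using assms by (simp add: shelling_def)
  have dw: "distinct w" using g by (simp add: gauss_word_def)
  have sh: "distinct (sh p)" "set (sh p) \<inter> chords w = {}" if "p \<in> set w" for p
    using shellingD[OF assms that] by auto
  have no: "Ini \<sigma> \<notin> set w" "Ter \<sigma> \<notin> set w" if "p \<in> set w" "\<sigma> \<in> set (sh p)" for p \<sigma>
    using sh[OF that(1)] that gauss_word_set[OF g] by auto
  have "distinct (expand w sh)"
    unfolding expand_def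
  proof (rule distinct_concat_map[OF dw])
    fix p assume p: "p \<in> set w"
    have "p \<notin> Ini ` set (sh p)" "p \<notin> Ter ` set (sh p)" using no[OF p] p by auto
    then show "distinct (surround (sh p) p)"
      using sh[OF p] by (auto simp: surround_def distinct_map inj_on_def)
  next
    fix p q assume pq: "p \<in> set w" "q \<in> set w" "p \<noteq> q"
    then have "set (sh p) \<inter> set (sh q) = {}" using shelling_disjoint[OF assms] by simp
    moreover have "p \<notin> Ini ` set (sh q)" "p \<notin> Ter ` set (sh q)" "q \<notin> Ini ` set (sh p)" "q \<notin> Ter ` set (sh p)"
      using no pq by blast+
    ultimately show "set (surround (sh p) p) \<inter> set (surround (sh q) q) = {}"
      using pq by (auto simp: set_surround)
  qed
  moreover have "Ini \<gamma> \<in> set (expand w sh) \<longleftrightarrow> \<gamma> \<in> chords w \<union> (\<Union>p\<in>set w. set (sh p))"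
    "Ter \<gamma> \<in> set (expand w sh) \<longleftrightarrow> \<gamma> \<in> chords w \<union> (\<Union>p\<in>set w. set (sh p))" for \<gamma>
    by (auto simp: set_expand gauss_word_set[OF g])
  moreover have "sign \<gamma> \<in> {1, - 1}" if "\<gamma> \<in> chords w \<union> (\<Union>p\<in>set w. set (sh p))" for \<gamma>
    using that shellingD(3)[OF assms, of _ \<gamma>] g unfolding gauss_word_def by blast
  ultimately show ?thesis
    unfolding gauss_word_def chords_def[of "expand w sh"] by simp
qed

section \<open>Shells with fresh names and prescribed totals\<close>

lemma fresh_names:
  assumes "finite (A :: chord set)"
  shows "\<exists>N. \<forall>m s. m \<ge> N \<longrightarrow> (m, s) \<notin> A"
proof -
  obtain N where "\<forall>a\<in>fst ` A. a < N"
    using assms finite_nat_set_iff_bounded[of "fst ` A"] by auto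
  then show ?thesis by (intro exI[of _ N]) force
qed

text \<open>\<open>A\<close> collects names to be avoided and \<open>B\<close> the endpoints that
  must stay bare. As \<open>B\<close> contains at most one endpoint of each chord, the other one can
  carry all the shells.\<close>

lemma shelling_exists:
  assumes "gauss_word w" "finite A" "\<And>\<gamma>. \<not> (Ini \<gamma> \<in> B \<and> Ter \<gamma> \<in> B)"
  shows "\<exists>sh. shelling w sh \<and> (\<forall>\<gamma>. shell_total sh \<gamma> = k \<gamma>) \<and> (\<forall>p. set (sh p) \<inter> A = {}) \<and> (\<forall>p\<in>B. sh p = [])"
proof -
  obtain N where N: "(m, s) \<notin> A \<union> chords w" if "m \<ge> N" for m s
    using fresh_names[of "A \<union> chords w"] assms(2) by auto
  \<comment> \<open>\<open>to_nat\<close> encodes chord and counter, so shells of different chords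
    never share a name. For \<open>k \<gamma> = 0\<close> the list is empty and the sign 0 does not
    arise.\<close>
  define S where "S \<gamma> = map (\<lambda>j. (N + to_nat (\<gamma>, j), sgn (k \<gamma>))) [0..<nat \<bar>k \<gamma>\<bar>]" for \<gamma>
  define c where "c \<gamma> = (if Ini \<gamma> \<in> B then Ter \<gamma> else Ini \<gamma>)" for \<gamma>
  define sh where "sh p = (if p = c (chord_of p) then S (chord_of p) else [])" for p
  have S: "distinct (S \<gamma>)" "set (S \<gamma>) \<inter> (A \<union> chords w) = {}" "\<forall>\<sigma>\<in>set (S \<gamma>). sign \<sigma> \<in> {1, - 1}" for \<gamma>
    using N by (auto simp: S_def distinct_map inj_on_def sgn_if)
  have disj: "set (S \<gamma>) \<inter> set (S \<delta>) = {}" if "\<gamma> \<noteq> \<delta>" for \<gamma> \<delta>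
    using that by (auto simp: S_def)
  have disj_sh: "set (sh p) \<inter> set (sh q) = {}" if "p \<noteq> q" for p q
  proof (cases "chord_of p = chord_of q")
    case True
    then show ?thesis using that by (auto simp: sh_def)
  next
    case False
    then show ?thesis using disj[of "chord_of p" "chord_of q"] unfolding sh_def by auto
  qed
  have "sign_sum (S \<gamma>) = k \<gamma>" for \<gamma>
    by (simp add: S_def o_def sum_list_triv mult_sgn_abs abs_mult_sgn)
  then have "shell_total sh \<gamma> = k \<gamma>" for \<gamma>
    by (simp add: shell_total_def sh_def c_def)
  moreover have "shelling w sh"
  proof (rule shellingI[OF assms(1) _ _ _ disj_sh])
    fix p
    show "distinct (sh p)" "set (sh p) \<inter> chords w = {}" "\<sigma> \<in> set (sh p) \<Longrightarrow> sign \<sigma> \<in> {1, - 1}" for \<sigma>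
      using S[of "chord_of p"] unfolding sh_def by auto
  qed
  moreover have "sh p = []" if "p \<in> B" for p
    using that assms(3) by (cases p) (auto simp: sh_def c_def)
  moreover have "set (sh p) \<inter> A = {}" for p
    using S(2)[of "chord_of p"] by (auto simp: sh_def)
  ultimately show ?thesis by blast
qed

section \<open>Cancellation of shells by R2\<close>

lemma word_equiv_R2:
  assumes "gauss_word (A @ [Ini a, Ini b] @ M @ [Ter b, Ter a] @ B)" "gauss_word (A @ M @ B)"
    "sign b = - sign a"
  shows "word_equiv (A @ [Ini a, Ini b] @ M @ [Ter b, Ter a] @ B) (A @ M @ B)"
proof -
  have 1: "word_equiv (A @ ([Ini a, Ini b] @ M @ [Ter b, Ter a] @ B)) (([Ini a, Ini b] @ M @ [Ter b, Ter a] @ B) @ A)"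
    using assms(1) by (intro word_equiv_rotate) simp
  have 2: "word_equiv (A @ (M @ B)) ((M @ B) @ A)"
    using assms(2) by (intro word_equiv_rotate) simp
  have "reidemeister_word (M @ (B @ A)) ([Ini a, Ini b] @ M @ [Ter b, Ter a] @ (B @ A))"
    by (rule R2_antiparallel[OF assms(3)])
  then have "word_equiv ((M @ B) @ A) (([Ini a, Ini b] @ M @ [Ter b, Ter a] @ B) @ A)"
    using 1 2 by (intro word_equiv_step) (auto simp: word_equiv_def)
  then show ?thesis using word_equiv_conj[OF 1 2 word_equiv_sym] by simp
qed

text \<open>The arrangement around a negative endpoint. Seen from the base point at
  \<open>Ini b\<close>, it is the pattern of \<open>word_equiv_R2\<close> with \<open>a\<close> and
  \<open>b\<close> interchanged and \<open>B @ A\<close> in the role of the middle arc.\<close>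

lemma word_equiv_R2_swapped:
  assumes "gauss_word (A @ [Ter a, Ter b] @ M @ [Ini b, Ini a] @ B)" "gauss_word (A @ M @ B)"
    "sign b = - sign a"
  shows "word_equiv (A @ [Ter a, Ter b] @ M @ [Ini b, Ini a] @ B) (A @ M @ B)"
proof -
  let ?L = "A @ [Ter a, Ter b] @ M" and ?R = "[Ini b, Ini a] @ B"
  have 1: "word_equiv (?L @ ?R) (?R @ ?L)"
    using assms(1) by (intro word_equiv_rotate) simp
  have 2: "word_equiv ((A @ M) @ B) (B @ (A @ M))"
    using assms(2) by (intro word_equiv_rotate) simp
  have "word_equiv ([] @ [Ini b, Ini a] @ (B @ A) @ [Ter a, Ter b] @ M) ([] @ (B @ A) @ M)"
    using 1 2 assms(3) by (intro word_equiv_R2) (auto simp: word_equiv_def)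
  then show ?thesis using word_equiv_conj[OF 1 2] by simp
qed

text \<open>One context \<open>X\<close>, \<open>Y\<close> serves all \<open>ss\<close>, so that a
  change of the shells at \<open>p\<close> is a local replacement.\<close>

lemma expand_split:
  assumes "gauss_word w" "p \<in> set w"
  shows "\<exists>X Y. \<forall>ss. expand w (sh(p := ss)) = X @ surround ss p @ Y"
proof -
  obtain u v where w: "w = u @ p # v" using assms(2) by (meson split_list)
  then have "p \<notin> set u" "p \<notin> set v" using assms(1) by (auto simp: gauss_word_def)
  then show ?thesis by (auto simp: w)
qed

lemma shelling_fun_upd_subset:
  assumes "shelling w sh" "p \<in> set w" "distinct ss" "set ss \<subseteq> set (sh p)"
  shows "shelling w (sh(p := ss))"
proof (rule shelling_fun_upd[OF assms(1,3)])
  show "set ss \<inter> set (sh q) = {}" if "q \<in> set w" "q \<noteq> p" for q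
    using shelling_disjoint[OF assms(1,2) that(1)] that assms(4) by blast
qed (use assms shellingD[OF assms(1,2)] in blast)+

text \<open>Consecutive shells are nested: their initial endpoints are adjacent on one side of
  \<open>p\<close> and their terminal endpoints on the other, in reverse order. This is the
  antiparallel form of R2.\<close>

lemma cancel_adjacent_shells:
  assumes "shelling w sh" "p \<in> set w" "sh p = xs @ [a, b] @ ys" "sign b = - sign a"
  shows "word_equiv (expand w sh) (expand w (sh(p := xs @ ys)))"
proof -
  have g: "gauss_word w" using assms by (simp add: shelling_def)
  obtain X Y where XY: "\<And>ss. expand w (sh(p := ss)) = X @ surround ss p @ Y"
    using expand_split[OF g assms(2)] by blast
  have "distinct (sh p)" using shellingD[OF assms(1,2)] by simp
  then have sh': "shelling w (sh(p := xs @ ys))"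
    using assms by (intro shelling_fun_upd_subset) auto
  have e: "expand w sh = X @ surround (xs @ [a, b] @ ys) p @ Y"
    using XY[of "sh p"] fun_upd_triv[of sh p] by (simp add: assms(3))
  have ge: "gauss_word (X @ surround (xs @ [a, b] @ ys) p @ Y)" "gauss_word (X @ surround (xs @ ys) p @ Y)"
    using gauss_word_expand[OF assms(1)] gauss_word_expand[OF sh'] by (simp_all only: e XY)
  show ?thesis
  proof (cases "endpoint_sign p = 1")
    case True
    show ?thesis unfolding e XY
      using word_equiv_R2[of "X @ map Ini xs" a b "map Ini ys @ [p] @ map Ter (rev ys)" "map Ter (rev xs) @ Y"]
        ge assms(4) True
      by (simp add: surround_def)
  next
    case False
    show ?thesis unfolding e XY
      using word_equiv_R2_swapped[of "X @ map Ter xs" a b "map Ter ys @ [p] @ map Ini (rev ys)" "map Ini (rev xs) @ Y"]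
        ge assms(4) False
      by (simp add: surround_def)
  qed
qed

lemma adjacent_opposite_signs:
  assumes "\<forall>\<sigma>\<in>set zs. sign \<sigma> \<in> {1, - 1}"
  shows "(\<exists>xs a b ys. zs = xs @ [a, b] @ ys \<and> sign b = - sign a) \<or> (\<exists>s\<in>{1, - 1}. \<forall>\<sigma>\<in>set zs. sign \<sigma> = s)"
  using assms
proof (induction zs)
  case (Cons a zs)
  show ?case
  proof (cases zs)
    case Nil
    then show ?thesis using Cons.prems by auto
  next
    case (Cons b ys)
    show ?thesis
    proof (cases "sign b = - sign a")
      case True
      then show ?thesis using Cons by (metis append_Cons append_Nil)
    next
      case False
      then have "sign b = sign a" using Cons.prems Cons by auto
      from Cons.IH Cons.prems have "(\<exists>xs a b ys. zs = xs @ [a, b] @ ys \<and> sign b = - sign a)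
          \<or> (\<exists>s\<in>{1, - 1}. \<forall>\<sigma>\<in>set zs. sign \<sigma> = s)" by auto
      then show ?thesis
      proof
        assume "\<exists>xs a b ys. zs = xs @ [a, b] @ ys \<and> sign b = - sign a"
        then show ?thesis by (metis append_Cons)
      next
        assume "\<exists>s\<in>{1, - 1}. \<forall>\<sigma>\<in>set zs. sign \<sigma> = s"
        then show ?thesis using \<open>sign b = sign a\<close> Cons by auto
      qed
    qed
  qed
qed auto

text \<open>A nonempty list of signs with sum zero is not constant, so it has two opposite
  neighbours. Removing them leaves the sum at zero, and induction on the length finishes.\<close>

lemma cancel_shells:
  assumes "shelling w sh" "p \<in> set w" "sh p = xs @ zs @ ys" "sign_sum zs = 0"
  shows "word_equiv (expand w sh) (expand w (sh(p := xs @ ys)))"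
  using assms
proof (induction "length zs" arbitrary: zs sh rule: less_induct)
  case less
  show ?case
  proof (cases "zs = []")
    case True
    then have "sh(p := xs @ ys) = sh" using less.prems(3) by (simp add: fun_upd_idem)
    then show ?thesis using gauss_word_expand[OF less.prems(1)] word_equiv_refl by simp
  next
    case False
    have d: "distinct (sh p)" and pm: "\<forall>\<sigma>\<in>set zs. sign \<sigma> \<in> {1, - 1}"
      using shellingD[OF less.prems(1,2)] less.prems(3) by auto
    have "\<not> (\<exists>s\<in>{1, - 1}. \<forall>\<sigma>\<in>set zs. sign \<sigma> = s)"
    proof
      assume "\<exists>s\<in>{1, - 1}. \<forall>\<sigma>\<in>set zs. sign \<sigma> = s"
      then obtain s :: int where s: "s \<in> {1, - 1}" "\<forall>\<sigma>\<in>set zs. sign \<sigma> = s" by blast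
      then have "map sign zs = map (\<lambda>_. s) zs" by simp
      then have "sign_sum zs = int (length zs) * s" by (simp only: sum_list_triv)
      then show False using s(1) False less.prems(4) by auto
    qed
    then obtain us a b vs where zs: "zs = us @ [a, b] @ vs" "sign b = - sign a"
      using adjacent_opposite_signs[OF pm] by blast
    let ?sh = "sh(p := xs @ (us @ vs) @ ys)"
    have 1: "word_equiv (expand w sh) (expand w ?sh)"
      using cancel_adjacent_shells[OF less.prems(1,2), of "xs @ us" a b "vs @ ys"] zs less.prems by simp
    have "shelling w ?sh"
      using less.prems zs d by (intro shelling_fun_upd_subset) auto
    then have 2: "word_equiv (expand w ?sh) (expand w (?sh(p := xs @ ys)))"
      using less.prems zs by (intro less.hyps[of "us @ vs"]) auto
    show ?thesis using word_equiv_trans[OF 1 2] by simp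
  qed
qed

text \<open>Both sides arise from the shells \<open>sh p @ ns @ ts\<close>, where \<open>ns\<close>
  are fresh shells with the signs opposite to those of \<open>ts\<close>. Cancelling
  \<open>ns @ ts\<close> leaves \<open>sh p\<close>; cancelling \<open>sh p @ ns\<close> leaves
  \<open>ts\<close>.\<close>

lemma replace_shells:
  assumes "shelling w sh" "shelling w (sh(p := ts))" "p \<in> set w"
    "set ts \<inter> set (sh p) = {}" "sign_sum ts = sign_sum (sh p)"
  shows "word_equiv (expand w sh) (expand w (sh(p := ts)))"
proof -
  obtain N where N: "(m, s) \<notin> chords w \<union> set ts \<union> (\<Union>q\<in>set w. set (sh q))" if "m \<ge> N" for m s
    using fresh_names[of "chords w \<union> set ts \<union> (\<Union>q\<in>set w. set (sh q))"] by auto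
  define ns where "ns = map (\<lambda>j. (N + j, - sign (ts ! j))) [0..<length ts]"
  have ns: "sign_sum ns = - sign_sum ts"
    by (simp add: ns_def o_def sum_list_sum_nth sum_negf atLeast0LessThan)
  have new: "distinct ns" "set ns \<inter> (chords w \<union> set ts \<union> (\<Union>q\<in>set w. set (sh q))) = {}"
    using N by (fastforce simp: ns_def distinct_map inj_on_def)+
  have "sign (ts ! j) \<in> {1, - 1}" if "j < length ts" for j
    using shellingD(3)[OF assms(2,3), of "ts ! j"] that by simp
  then have nsgn: "\<forall>\<sigma>\<in>set ns. sign \<sigma> \<in> {1, - 1}"
    by (force simp: ns_def)
  let ?sh = "sh(p := sh p @ ns @ ts)"
  have ts: "distinct ts" "set ts \<inter> chords w = {}" "\<sigma> \<in> set ts \<Longrightarrow> sign \<sigma> \<in> {1, - 1}" for \<sigma>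
    using shellingD(1,2)[OF assms(2,3)] shellingD(3)[OF assms(2,3), of \<sigma>] by simp_all
  note ps = shellingD[OF assms(1,3)]
  have ns_new: "set ns \<inter> chords w = {}" "set ns \<inter> set ts = {}" "q \<in> set w \<Longrightarrow> set ns \<inter> set (sh q) = {}" for q
    using new(2) by blast+
  have sh: "shelling w ?sh"
  proof (rule shelling_fun_upd[OF assms(1)])
    show "distinct (sh p @ ns @ ts)" using ts(1) ps(1) new(1) ns_new(2) ns_new(3)[OF assms(3)] assms(4)
      by (simp add: Int_Un_distrib Int_commute)
    show "set (sh p @ ns @ ts) \<inter> chords w = {}" using ts(2) ps(2) ns_new(1) by (simp add: Int_Un_distrib2)
    show "sign \<sigma> \<in> {1, - 1}" if "\<sigma> \<in> set (sh p @ ns @ ts)" for \<sigma>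
      using that ts(3) ps(3) nsgn unfolding set_append by blast
    show "set (sh p @ ns @ ts) \<inter> set (sh q) = {}" if "q \<in> set w" "q \<noteq> p" for q
      using that ns_new(3) shelling_disjoint[OF assms(1,3) that(1)] shelling_disjoint[OF assms(2,3) that(1)]
      by (simp add: Int_Un_distrib2)
  qed
  have 1: "word_equiv (expand w ?sh) (expand w (?sh(p := sh p @ [])))"
    by (rule cancel_shells[OF sh assms(3), where zs = "ns @ ts"]) (use ns in simp_all)
  have 2: "word_equiv (expand w ?sh) (expand w (?sh(p := [] @ ts)))"
    by (rule cancel_shells[OF sh assms(3), where zs = "sh p @ ns"]) (use ns assms(5) in simp_all)
  show ?thesis
    using word_equiv_trans[OF word_equiv_sym[OF 1] 2] by simp
qed

section \<open>Transfer of shells along a chord by S1\<close>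

lemma surround_snoc_split:
  "\<exists>X Y. surround ss p = X @ [p] @ Y \<and> (\<forall>\<sigma>. surround (ss @ [\<sigma>]) p = X @ shelled \<sigma> p @ Y)"
  by (intro exI[of _ "if endpoint_sign p = 1 then map Ini ss else map Ter ss"]
      exI[of _ "if endpoint_sign p = 1 then map Ter (rev ss) else map Ini (rev ss)"])
    (simp add: surround_def shelled_def)

text \<open>S1 removes and inserts innermost shells, that is, last entries of the lists. Although
  \<open>w\<close> begins with \<open>p\<close>, the outer shells of \<open>p\<close> precede it in
  the expansion, so the base point still has to pass the block \<open>X\<close>.\<close>

lemma transfer_shell_aux:
  assumes "shelling w sh" "shelling w (sh(p := ss, q := sh q @ [\<sigma>]))" "w = p # v @ q # z"
    "chord_of p = chord_of q" "sh p = ss @ [\<sigma>]"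
  shows "word_equiv (expand w sh) (expand w (sh(p := ss, q := sh q @ [\<sigma>])))"
proof -
  have d: "p \<noteq> q" "p \<notin> set v" "q \<notin> set v" "p \<notin> set z" "q \<notin> set z"
    using shelling_gauss_word[OF assms(1)] by (auto simp: gauss_word_def assms(3))
  obtain X Y where XY: "surround ss p = X @ [p] @ Y" "\<And>\<sigma>. surround (ss @ [\<sigma>]) p = X @ shelled \<sigma> p @ Y"
    using surround_snoc_split by blast
  obtain X' Y' where XY': "surround (sh q) q = X' @ [q] @ Y'"
    "\<And>\<sigma>. surround (sh q @ [\<sigma>]) q = X' @ shelled \<sigma> q @ Y'"
    using surround_snoc_split by blast
  let ?U = "Y @ expand v sh @ X'" and ?V = "Y' @ expand z sh @ X"
  have e: "expand w sh = X @ shelled \<sigma> p @ ?U @ [q] @ Y' @ expand z sh"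
    "expand w (sh(p := ss, q := sh q @ [\<sigma>])) = X @ [p] @ ?U @ shelled \<sigma> q @ Y' @ expand z sh"
    using d by (simp_all add: assms(3,5) XY XY')
  have 1: "word_equiv (X @ (shelled \<sigma> p @ ?U @ [q] @ Y' @ expand z sh)) ((shelled \<sigma> p @ ?U @ [q] @ Y' @ expand z sh) @ X)"
    using gauss_word_expand[OF assms(1)] unfolding e by (rule word_equiv_rotate)
  have 2: "word_equiv (X @ ([p] @ ?U @ shelled \<sigma> q @ Y' @ expand z sh)) (([p] @ ?U @ shelled \<sigma> q @ Y' @ expand z sh) @ X)"
    using gauss_word_expand[OF assms(2)] unfolding e by (rule word_equiv_rotate)
  have "{p, q} = {Ini (chord_of p), Ter (chord_of p)}"
    using assms(4) d(1) by (cases p; cases q) auto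
  then have "shell_word (shelled \<sigma> p @ ?U @ [q] @ ?V) ([p] @ ?U @ shelled \<sigma> q @ ?V)"
    by (rule S1) simp
  then have "word_equiv ((shelled \<sigma> p @ ?U @ [q] @ Y' @ expand z sh) @ X) (([p] @ ?U @ shelled \<sigma> q @ Y' @ expand z sh) @ X)"
    using 1 2 by (intro word_equiv_step) (simp_all add: word_equiv_def)
  then show ?thesis unfolding e by (rule word_equiv_conj[OF 1 2])
qed

lemma shelling_cong_set:
  assumes "shelling w sh" "gauss_word w'" "set w' = set w"
  shows "shelling w' sh"
proof (rule shellingI[OF assms(2)])
  have c: "chords w' = chords w" by (simp add: chords_def assms(3))
  fix p assume p: "p \<in> set w'"
  show "distinct (sh p)" using p assms(3) shellingD(1)[OF assms(1)] by simp
  show "set (sh p) \<inter> chords w' = {}" using p assms(3) shellingD(2)[OF assms(1)] c by simp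
  show "sign \<sigma> \<in> {1, - 1}" if "\<sigma> \<in> set (sh p)" for \<sigma>
    using that p assms(3) shellingD(3)[OF assms(1)] by blast
  show "set (sh p) \<inter> set (sh q) = {}" if "q \<in> set w'" "p \<noteq> q" for q
    using that p assms(3) shelling_disjoint[OF assms(1)] by simp
qed

lemma word_equiv_expand_rotate:
  "shelling (u @ v) sh \<Longrightarrow> word_equiv (expand (u @ v) sh) (expand (v @ u) sh)"
  using gauss_word_expand[of "u @ v" sh] word_equiv_rotate[of "expand u sh" "expand v sh"] by simp

lemma shelling_transfer:
  assumes "shelling w sh" "p \<in> set w" "q \<in> set w" "p \<noteq> q" "distinct (ss @ ts)" "set ss \<union> set ts \<subseteq> set (sh p) \<union> set (sh q)"
  shows "shelling w (sh(p := ss, q := ts))"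
proof -
  note P = shellingD[OF assms(1,2)] and Q = shellingD[OF assms(1,3)]
  have C: "(set ss \<union> set ts) \<inter> chords w = {}" using P(2) Q(2) assms(6) by blast
  have S: "sign \<sigma> \<in> {1, - 1}" if "\<sigma> \<in> set ss \<union> set ts" for \<sigma>
    using that P(3) Q(3) assms(6) by blast
  have D: "(set ss \<union> set ts) \<inter> set (sh r) = {}" if "r \<in> set w" "r \<noteq> p" "r \<noteq> q" for r
    using shelling_disjoint[OF assms(1,2) that(1)] shelling_disjoint[OF assms(1,3) that(1)] that assms(6)
    by blast
  \<comment> \<open>Both endpoints are emptied first, since filling \<open>p\<close> while
    \<open>q\<close> keeps its old shells could use a shell twice.\<close>
  have "shelling w (sh(p := [], q := []))"
    by (intro shelling_fun_upd assms(1)) auto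
  then have "shelling w (sh(p := [], q := [], p := ss))"
  proof (rule shelling_fun_upd)
    show "set ss \<inter> set ((sh(p := [], q := [])) r) = {}" if "r \<in> set w" "r \<noteq> p" for r
      using D[of r] that by auto
  qed (use assms(5) C S in auto)
  then have "shelling w (sh(p := [], q := [], p := ss, q := ts))"
  proof (rule shelling_fun_upd)
    show "set ts \<inter> set ((sh(p := [], q := [], p := ss)) r) = {}" if "r \<in> set w" "r \<noteq> q" for r
      using D[of r] that assms(4,5) by auto
  qed (use assms(5) C S in auto)
  then show ?thesis using assms(4) by (simp add: fun_upd_twist)
qed

lemma transfer_shell:
  assumes "shelling w sh" "p \<in> set w" "q \<in> set w" "p \<noteq> q" "chord_of p = chord_of q" "sh p = ss @ [\<sigma>]"
  shows "word_equiv (expand w sh) (expand w (sh(p := ss, q := sh q @ [\<sigma>])))"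
    and "shelling w (sh(p := ss, q := sh q @ [\<sigma>]))"
proof -
  let ?sh = "sh(p := ss, q := sh q @ [\<sigma>])"
  have "distinct (sh p)" "distinct (sh q)" "set (sh p) \<inter> set (sh q) = {}"
    using shellingD(1)[OF assms(1)] shelling_disjoint[OF assms(1-4)] assms(2,3) by auto
  then show sh': "shelling w ?sh"
    using assms(6) by (intro shelling_transfer[OF assms(1-4)]) auto
  obtain u x where w: "w = u @ p # x" using assms(2) by (meson split_list)
  have "q \<in> set (x @ u)" using assms(3,4) w by auto
  then obtain v z where vz: "x @ u = v @ q # z" by (meson split_list)
  let ?w = "(p # x) @ u"
  have eq: "?w = p # v @ q # z" using vz by simp
  have g: "gauss_word ?w" using gauss_word_cong_mset[OF shelling_gauss_word[OF assms(1)]] w by simp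
  have "shelling ?w sh" "shelling ?w ?sh"
    using shelling_cong_set[OF assms(1) g] shelling_cong_set[OF sh' g] w by auto
  then have 1: "word_equiv (expand ?w sh) (expand ?w ?sh)"
    using eq assms(5,6) by (rule transfer_shell_aux)
  have 2: "word_equiv (expand w sh) (expand ?w sh)"
    using word_equiv_expand_rotate[of u "p # x" sh] assms(1) by (simp add: w)
  have 3: "word_equiv (expand w ?sh) (expand ?w ?sh)"
    using word_equiv_expand_rotate[of u "p # x" ?sh] sh' by (simp only: w)
  show "word_equiv (expand w sh) (expand w ?sh)"
    by (rule word_equiv_conj[OF 2 3 1])
qed

text \<open>The innermost shell goes first and ends up outside the later ones, whence the
  reversal.\<close>

lemma transfer_shells:
  assumes "shelling w sh" "p \<in> set w" "q \<in> set w" "p \<noteq> q" "chord_of p = chord_of q"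
  shows "word_equiv (expand w sh) (expand w (sh(p := [], q := sh q @ rev (sh p))))
    \<and> shelling w (sh(p := [], q := sh q @ rev (sh p)))"
  using assms
proof (induction "sh p" arbitrary: sh rule: rev_induct)
  case Nil
  then have eq: "sh(p := [], q := sh q @ rev (sh p)) = sh" by (simp add: fun_eq_iff)
  show ?case
    unfolding eq using word_equiv_refl[OF gauss_word_expand[OF Nil.prems(1)]] Nil.prems(1) by blast
next
  case (snoc \<sigma> ss)
  let ?sh = "sh(p := ss, q := sh q @ [\<sigma>])"
  note s = transfer_shell[OF snoc.prems(1-5) snoc.hyps(2)[symmetric]]
  have "sh p = ss @ [\<sigma>]" using snoc.hyps(2) by simp
  then have eq: "?sh(p := [], q := ?sh q @ rev (?sh p)) = sh(p := [], q := sh q @ rev (sh p))"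
    using snoc.prems(4) by (simp add: fun_eq_iff)
  have p: "ss = ?sh p" using snoc.prems(4) by simp
  show ?case
    using snoc.hyps(1)[OF p s(2) snoc.prems(2-5)] word_equiv_trans[OF s(1)] unfolding eq by blast
qed

section \<open>Words up to moves that keep the indices\<close>

lemma same_chord_endpoints:
  "chord_of x = chord_of q \<Longrightarrow> chord_of p = chord_of q \<Longrightarrow> p \<noteq> q \<Longrightarrow> x = p \<or> x = q"
  by (cases x; cases p; cases q) simp_all

lemma sign_sum_rev: "sign_sum (rev ss) = sign_sum ss"
  by (induction ss) auto

text \<open>The chords are treated one by one: S1 gathers the shells of a chord at its initial
  endpoint, then \<open>replace_shells\<close> substitutes the new ones. Since \<open>sh'\<close>
  shares no shell with \<open>sh\<close>, every intermediate stage \<open>mix A\<close>, with the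
  chords of \<open>A\<close> done, is again a shelling.\<close>

lemma word_equiv_replace_all_shells:
  assumes sh: "shelling w sh" and sh': "shelling w sh'"
    and new: "\<And>p q. p \<in> set w \<Longrightarrow> q \<in> set w \<Longrightarrow> set (sh' p) \<inter> set (sh q) = {}"
    and ini: "\<And>\<gamma>. sh' (Ter \<gamma>) = []"
    and tot: "\<And>\<gamma>. \<gamma> \<in> chords w \<Longrightarrow> shell_total sh' \<gamma> = shell_total sh \<gamma>"
  shows "word_equiv (expand w sh) (expand w sh')"
proof -
  define mix where "mix A p = (if chord_of p \<in> A then sh' p else sh p)" for A p
  have mix: "shelling w (mix A)" for A
  proof (rule shellingI)
    fix p assume p: "p \<in> set w"
    have "mix A p = sh p \<or> mix A p = sh' p" by (simp add: mix_def)
    then show "distinct (mix A p)" "set (mix A p) \<inter> chords w = {}"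
      "\<And>\<sigma>. \<sigma> \<in> set (mix A p) \<Longrightarrow> sign \<sigma> \<in> {1, - 1}"
      using shellingD[OF sh p] shellingD[OF sh' p] by metis+
    show "set (mix A p) \<inter> set (mix A q) = {}" if "q \<in> set w" "p \<noteq> q" for q
      using new[OF p that(1)] new[OF that(1) p] shelling_disjoint[OF sh p that] shelling_disjoint[OF sh' p that]
      unfolding mix_def by (cases "chord_of p \<in> A"; cases "chord_of q \<in> A") (simp_all only: if_True if_False Int_commute)
  qed (rule shelling_gauss_word[OF sh])
  have "word_equiv (expand w sh) (expand w (mix A))" if "finite A" "A \<subseteq> chords w" for A
    using that
  proof (induction A)
    case empty
    have "mix {} = sh" by (simp add: mix_def fun_eq_iff)
    then show ?case using word_equiv_refl[OF gauss_word_expand[OF sh]] by simp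
  next
    case (insert \<gamma> A)
    then have "\<gamma> \<in> chords w" by simp
    then have mem: "Ter \<gamma> \<in> set w" "Ini \<gamma> \<in> set w"
      using gauss_word_memD[OF shelling_gauss_word[OF sh]] by auto
    let ?m = "(mix A)(Ter \<gamma> := [], Ini \<gamma> := mix A (Ini \<gamma>) @ rev (mix A (Ter \<gamma>)))"
    have s: "word_equiv (expand w (mix A)) (expand w ?m)" "shelling w ?m"
      using transfer_shells[OF mix[of A] mem] by simp_all
    have m: "?m(Ini \<gamma> := sh' (Ini \<gamma>)) = mix (insert \<gamma> A)"
    proof
      fix p show "(?m(Ini \<gamma> := sh' (Ini \<gamma>))) p = mix (insert \<gamma> A) p"
        using ini by (cases p) (auto simp: mix_def)
    qed
    have "word_equiv (expand w ?m) (expand w (?m(Ini \<gamma> := sh' (Ini \<gamma>))))"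
    proof (rule replace_shells[OF s(2)])
      show "shelling w (?m(Ini \<gamma> := sh' (Ini \<gamma>)))" unfolding m by (rule mix)
      show "Ini \<gamma> \<in> set w" by fact
      show "set (sh' (Ini \<gamma>)) \<inter> set (?m (Ini \<gamma>)) = {}"
        using new[OF mem(2) mem(1)] new[OF mem(2) mem(2)] insert.hyps(2) by (simp add: mix_def Int_Un_distrib)
      show "sign_sum (sh' (Ini \<gamma>)) = sign_sum (?m (Ini \<gamma>))"
        using tot[OF \<open>\<gamma> \<in> chords w\<close>] insert.hyps(2) ini[of \<gamma>] by (simp add: mix_def shell_total_def sign_sum_rev)
    qed
    then have 2: "word_equiv (expand w ?m) (expand w (mix (insert \<gamma> A)))" unfolding m .
    have 1: "word_equiv (expand w sh) (expand w (mix A))"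
      using insert.IH insert.prems by simp
    show ?case by (rule word_equiv_trans[OF 1 word_equiv_trans[OF s(1) 2]])
  qed
  from this[of "chords w"] have "word_equiv (expand w sh) (expand w (mix (chords w)))" by simp
  moreover have "expand w (mix (chords w)) = expand w sh'"
    by (rule expand_cong) (simp add: mix_def chord_of_in_chords[OF shelling_gauss_word[OF sh]])
  ultimately show ?thesis by simp
qed

text \<open>Two arbitrary shellings may share shells or place them at different endpoints. Both are
  therefore compared with a third one, made of fresh shells at initial endpoints only.\<close>

lemma word_equiv_same_totals:
  assumes "shelling w sh" "shelling w sh'" "\<And>\<gamma>. \<gamma> \<in> chords w \<Longrightarrow> shell_total sh' \<gamma> = shell_total sh \<gamma>"
  shows "word_equiv (expand w sh) (expand w sh')"
proof -
  let ?A = "(\<Union>p\<in>set w. set (sh p) \<union> set (sh' p))"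
  obtain sh0 where sh0: "shelling w sh0" "\<And>\<gamma>. shell_total sh0 \<gamma> = shell_total sh \<gamma>"
    "\<And>p. set (sh0 p) \<inter> ?A = {}" "\<And>\<gamma>. sh0 (Ter \<gamma>) = []"
  proof -
    have fin: "finite ?A" by simp
    have B: "\<not> (Ini \<gamma> \<in> range Ter \<and> Ter \<gamma> \<in> range Ter)" for \<gamma> :: chord by auto
    obtain th where th: "shelling w th" "\<forall>\<gamma>. shell_total th \<gamma> = shell_total sh \<gamma>"
      "\<forall>p. set (th p) \<inter> ?A = {}" "\<forall>p\<in>range Ter. th p = []"
      using shelling_exists[OF shelling_gauss_word[OF assms(1)] fin B, of "shell_total sh"] by blast
    show thesis by (rule that[OF th(1)]) (use th(2-4) in blast)+
  qed
  have 1: "word_equiv (expand w sh) (expand w sh0)"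
  proof (rule word_equiv_replace_all_shells[OF assms(1) sh0(1) _ sh0(4) sh0(2)])
    show "set (sh0 p) \<inter> set (sh q) = {}" if "q \<in> set w" for p q
      using that sh0(3)[of p] by blast
  qed
  have 2: "word_equiv (expand w sh') (expand w sh0)"
  proof (rule word_equiv_replace_all_shells[OF assms(2) sh0(1) _ sh0(4)])
    show "set (sh0 p) \<inter> set (sh' q) = {}" if "q \<in> set w" for p q
      using that sh0(3)[of p] by blast
    show "shell_total sh0 \<gamma> = shell_total sh' \<gamma>" if "\<gamma> \<in> chords w" for \<gamma>
      unfolding sh0(2) assms(3)[OF that] ..
  qed
  show ?thesis by (rule word_equiv_trans[OF 1 word_equiv_sym[OF 2]])
qed

text \<open>
  The index of \<open>\<gamma>\<close> in \<open>expand w sh\<close> is \<open>index w \<gamma> - sign \<gamma> * shell_total sh \<gamma>\<close>.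
\<close>

definition represents :: "chord endpoint list \<Rightarrow> (chord \<Rightarrow> int) \<Rightarrow> (chord endpoint \<Rightarrow> chord list) \<Rightarrow> bool" where
  "represents w i sh \<longleftrightarrow> shelling w sh \<and> (\<forall>\<gamma>\<in>chords w. index w \<gamma> - sign \<gamma> * shell_total sh \<gamma> = i \<gamma>)"

text \<open>The same \<open>i\<close> governs both words, so it links chords that occur in both. The
  choice of representatives is harmless: by \<open>ind_equivD\<close> any other choice is equivalent
  too.\<close>

definition ind_equiv :: "(chord \<Rightarrow> int) \<Rightarrow> chord endpoint list \<Rightarrow> chord endpoint list \<Rightarrow> bool" where
  "ind_equiv i w w' \<longleftrightarrow> (\<exists>sh sh'. represents w i sh \<and> represents w' i sh' \<and> word_equiv (expand w sh) (expand w' sh'))"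

section \<open>Representation of prescribed indices\<close>

lemma representsD:
  assumes "represents w i sh"
  shows "shelling w sh" "gauss_word w" "\<gamma> \<in> chords w \<Longrightarrow> index w \<gamma> - sign \<gamma> * shell_total sh \<gamma> = i \<gamma>"
  using assms shelling_gauss_word[of w sh] by (simp_all add: represents_def)

lemma representsI:
  assumes "shelling w sh" "\<And>\<gamma>. \<gamma> \<in> chords w \<Longrightarrow> index w \<gamma> - sign \<gamma> * shell_total sh \<gamma> = i \<gamma>"
  shows "represents w i sh"
  using assms unfolding represents_def by blast

lemma gauss_word_sign_mult:
  "gauss_word w \<Longrightarrow> \<gamma> \<in> chords w \<Longrightarrow> sign \<gamma> * (sign \<gamma> * x) = x"
  unfolding gauss_word_def by fastforce

lemma represents_exists:
  assumes "gauss_word w" "finite A" "\<And>\<gamma>. \<not> (Ini \<gamma> \<in> B \<and> Ter \<gamma> \<in> B)"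
  shows "\<exists>sh. represents w i sh \<and> (\<forall>p. set (sh p) \<inter> A = {}) \<and> (\<forall>p\<in>B. sh p = [])"
proof -
  \<comment> \<open>The index equation solved for the shell total, using that a sign is its own
    inverse.\<close>
  obtain sh where sh: "shelling w sh" "\<forall>\<gamma>. shell_total sh \<gamma> = sign \<gamma> * (index w \<gamma> - i \<gamma>)"
    "\<forall>p. set (sh p) \<inter> A = {}" "\<forall>p\<in>B. sh p = []"
    using shelling_exists[OF assms, of "\<lambda>\<gamma>. sign \<gamma> * (index w \<gamma> - i \<gamma>)"] by blast
  have "represents w i sh"
    by (rule representsI[OF sh(1)]) (simp add: sh(2) gauss_word_sign_mult[OF assms(1)])
  then show ?thesis using sh(3,4) by blast
qed

text \<open>As signs are nonzero, the index equation fixes the shell total of each chord, and totals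
  suffice by \<open>word_equiv_same_totals\<close>.\<close>

lemma represents_unique:
  assumes "represents w i sh" "represents w i sh'"
  shows "word_equiv (expand w sh) (expand w sh')"
proof (rule word_equiv_same_totals)
  fix \<gamma> assume g: "\<gamma> \<in> chords w"
  then have "sign \<gamma> \<noteq> 0" using representsD(2)[OF assms(1)] unfolding gauss_word_def by fastforce
  moreover have "sign \<gamma> * shell_total sh' \<gamma> = sign \<gamma> * shell_total sh \<gamma>"
    using representsD(3)[OF assms(1) g] representsD(3)[OF assms(2) g] by linarith
  ultimately show "shell_total sh' \<gamma> = shell_total sh \<gamma>" by simp
qed (use assms representsD(1) in blast)+

lemma ind_equiv_refl: "gauss_word w \<Longrightarrow> ind_equiv i w w"
  using represents_exists[of w "{}" "{}" i] represents_unique[of w i] unfolding ind_equiv_def by blast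

lemma ind_equiv_sym: "ind_equiv i w w' \<Longrightarrow> ind_equiv i w' w"
  unfolding ind_equiv_def using word_equiv_sym by blast

lemma ind_equivD:
  assumes "ind_equiv i w w'" "represents w i sh" "represents w' i sh'"
  shows "word_equiv (expand w sh) (expand w' sh')"
proof -
  obtain th th' where th: "represents w i th" "represents w' i th'" "word_equiv (expand w th) (expand w' th')"
    using assms(1) unfolding ind_equiv_def by blast
  show ?thesis
    using word_equiv_trans[OF represents_unique[OF assms(2) th(1)]
        word_equiv_trans[OF th(3) represents_unique[OF th(2) assms(3)]]] .
qed

lemma ind_equiv_trans [trans]:
  assumes "ind_equiv i w w'" "ind_equiv i w' w''"
  shows "ind_equiv i w w''"
proof -
  obtain sh sh' where sh: "represents w i sh" "represents w' i sh'" "word_equiv (expand w sh) (expand w' sh')"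
    using assms(1) unfolding ind_equiv_def by blast
  obtain sh'' where sh'': "represents w'' i sh''"
    using assms(2) unfolding ind_equiv_def by blast
  show ?thesis
    using word_equiv_trans[OF sh(3) ind_equivD[OF assms(2) sh(2) sh'']] sh(1) sh''
    unfolding ind_equiv_def by blast
qed

lemma represents_cong:
  "(\<And>\<gamma>. \<gamma> \<in> chords w \<Longrightarrow> i \<gamma> = j \<gamma>) \<Longrightarrow> represents w i sh \<longleftrightarrow> represents w j sh"
  by (simp add: represents_def)

lemma ind_equiv_cong:
  assumes "\<And>\<gamma>. \<gamma> \<in> chords w \<union> chords w' \<Longrightarrow> i \<gamma> = j \<gamma>"
  shows "ind_equiv i w w' \<longleftrightarrow> ind_equiv j w w'"
  using represents_cong[of w i j] represents_cong[of w' i j] assms by (simp add: ind_equiv_def)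

section \<open>Rotation and exchange of neighbours with fixed indices\<close>

lemma index_rotate:
  assumes "gauss_word (u @ v)" "\<gamma> \<in> chords (u @ v)"
  shows "index (v @ u) \<gamma> = index (u @ v) \<gamma>"
proof -
  have g: "gauss_word (v @ u)" using gauss_word_cong_mset[OF assms(1)] by simp
  have "\<gamma> \<in> chords (v @ u)" using assms(2) by auto
  have "total u + total v = 0" using total_gauss_word[OF assms(1)] by simp
  moreover have "set u \<inter> set v = {}" using assms(1) by (auto simp: gauss_word_def)
  ultimately have shift: "prefix_sum (v @ u) x = prefix_sum (u @ v) x - total u" if "x \<in> set (u @ v)" for x
    using that by (auto simp: prefix_sum_append)
  show ?thesis
    using gauss_word_memD[OF assms]
    unfolding index_eq_prefix_sum[OF assms] index_eq_prefix_sum[OF g \<open>\<gamma> \<in> chords (v @ u)\<close>]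
    by (simp add: shift)
qed

lemma ind_equiv_rotate:
  assumes "gauss_word (u @ v)"
  shows "ind_equiv i (u @ v) (v @ u)"
proof -
  obtain sh where sh: "represents (u @ v) i sh"
    using represents_exists[OF assms, of "{}" "{}" i] by blast
  then have s: "shelling (u @ v) sh" by (simp add: represents_def)
  have "gauss_word (v @ u)" using gauss_word_cong_mset[OF assms] by simp
  then have "shelling (v @ u) sh" by (rule shelling_cong_set[OF s]) auto
  then have "represents (v @ u) i sh"
  proof (rule representsI)
    fix \<gamma> assume "\<gamma> \<in> chords (v @ u)"
    then have "\<gamma> \<in> chords (u @ v)" by simp blast
    then show "index (v @ u) \<gamma> - sign \<gamma> * shell_total sh \<gamma> = i \<gamma>"
      using representsD(3)[OF sh] index_rotate[OF assms] by simp
  qed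
  then show ?thesis
    using sh word_equiv_expand_rotate[OF s] unfolding ind_equiv_def by blast
qed

text \<open>Since \<open>p\<close> and \<open>q\<close> belong to different chords, both can be kept
  bare, and S2 applies directly. The exchange alters the plain index of the chord of
  \<open>p\<close> by its sign times \<open>e\<close>, and the new shell alters its total by
  \<open>e\<close>, so the represented index stays. For \<open>q\<close> the same holds with
  \<open>- e\<close>.\<close>

lemma ind_equiv_swap_front:
  assumes "gauss_word ([p, q] @ u)" "chord_of p \<noteq> chord_of q"
  shows "ind_equiv i ([p, q] @ u) ([q, p] @ u)"
proof -
  let ?w = "[p, q] @ u" and ?w' = "[q, p] @ u"
  define e where "e = endpoint_sign p * endpoint_sign q"
  have g': "gauss_word ?w'" using gauss_word_cong_mset[OF assms(1)] by simp
  have sp: "endpoint_sign p = 1 \<or> endpoint_sign p = - 1" "endpoint_sign q = 1 \<or> endpoint_sign q = - 1"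
    using endpoint_sign_cases[OF assms(1)] by auto
  then have e: "e = 1 \<or> e = - 1" by (auto simp: e_def)
  have pq: "p \<noteq> q" "p \<notin> set u" "q \<notin> set u" using assms by (auto simp: gauss_word_def)
  have ch: "chords ?w' = chords ?w" by (auto simp: chords_def)
  have index: "index ?w' \<gamma> = index ?w \<gamma> + sign \<gamma> * ((if \<gamma> = chord_of p then e else 0) - (if \<gamma> = chord_of q then e else 0))"
    if "\<gamma> \<in> chords ?w" for \<gamma>
  proof -
    have mem: "\<gamma> \<in> chords ?w'" using that ch by simp
    have shift: "prefix_sum ?w' x = prefix_sum ?w x + (if x = p then endpoint_sign q else 0)
        - (if x = q then endpoint_sign p else 0)" for x
      using pq by auto
    show ?thesis
      unfolding index_eq_prefix_sum[OF assms(1) that] index_eq_prefix_sum[OF g' mem] shift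
      using sp assms(2) by (cases p; cases q) (auto simp: e_def)
  qed
  have "\<not> (Ini \<gamma> \<in> {p, q} \<and> Ter \<gamma> \<in> {p, q})" for \<gamma> using assms(2) by auto
  then obtain sh where sh: "represents ?w i sh" "sh p = []" "sh q = []"
    using represents_exists[OF assms(1), of "{}" "{p, q}" i] by blast
  then have s: "shelling ?w sh" by (simp add: represents_def)
  let ?A = "chords ?w \<union> (\<Union>r\<in>set ?w. set (sh r))"
  obtain N where N: "(m, s) \<notin> ?A" if "m \<ge> N" for m s
  proof -
    have "finite ?A" by (intro finite_UnI finite_chords finite_UN_I finite_set)
    from fresh_names[OF this] show thesis using that by blast
  qed
  define \<sigma> where "\<sigma> = (N, e)"
  define \<tau> where "\<tau> = (Suc N, - e)"
  have new: "\<sigma> \<notin> ?A" "\<tau> \<notin> ?A" "\<sigma> \<noteq> \<tau>" "sign \<sigma> = e" "sign \<tau> = - e"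
    unfolding \<sigma>_def \<tau>_def using N by simp_all
  have s1: "shelling ?w (sh(p := [\<sigma>]))"
  proof (rule shelling_fun_upd[OF s])
    show "set [\<sigma>] \<inter> set (sh r) = {}" if "r \<in> set ?w" for r using that new(1) by auto
  qed (use new(1,4) e in simp_all)
  have s': "shelling ?w (sh(p := [\<sigma>], q := [\<tau>]))"
  proof (rule shelling_fun_upd[OF s1])
    show "set [\<tau>] \<inter> set ((sh(p := [\<sigma>])) r) = {}" if "r \<in> set ?w" for r
      using that new(2,3) by (cases "r = p") auto
  qed (use new(2,5) e in auto)
  let ?sh = "sh(p := [\<sigma>], q := [\<tau>])"
  have s'': "shelling ?w' ?sh"
    by (rule shelling_cong_set[OF s' g']) auto
  have tot: "shell_total ?sh \<gamma> = shell_total sh \<gamma> + ((if \<gamma> = chord_of p then e else 0) - (if \<gamma> = chord_of q then e else 0))" for \<gamma>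
    using sh(2,3) assms(2) new(4,5) by (cases p; cases q) (auto simp: shell_total_def)
  have "represents ?w' i ?sh"
    unfolding represents_def ch
  proof (intro conjI ballI s'')
    fix \<gamma> assume g: "\<gamma> \<in> chords ?w"
    then have "index ?w \<gamma> - sign \<gamma> * shell_total sh \<gamma> = i \<gamma>" using sh(1) by (simp add: represents_def)
    then show "index ?w' \<gamma> - sign \<gamma> * shell_total ?sh \<gamma> = i \<gamma>"
      unfolding index[OF g] tot distrib_left by linarith
  qed
  moreover have "word_equiv (expand ?w sh) (expand ?w' ?sh)"
  proof (rule word_equiv_step)
    show "gauss_word (expand ?w sh)" "gauss_word (expand ?w' ?sh)"
      using gauss_word_expand s s'' by blast+
    have eq: "expand ?w sh = [p, q] @ expand u sh" "expand ?w' ?sh = shelled \<tau> q @ shelled \<sigma> p @ expand u sh"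
      using sh(2,3) pq by (simp_all add: surround_single)
    have "shell_word ([p, q] @ expand u sh) (shelled \<tau> q @ shelled \<sigma> p @ expand u sh)"
      by (rule S2[OF assms(2)]) (simp_all add: new(4,5) e_def)
    then show "same_diagram (expand ?w sh) (expand ?w' ?sh) \<or> reidemeister_word (expand ?w sh) (expand ?w' ?sh)
        \<or> shell_word (expand ?w sh) (expand ?w' ?sh)" unfolding eq by blast
  qed
  ultimately show ?thesis using sh(1) unfolding ind_equiv_def by blast
qed

section \<open>Insertion of chords whose plain index is the prescribed one\<close>

lemma represents_extend:
  assumes "represents w i sh" "gauss_word w'" "chords w' = chords w \<union> Z" "chords w \<inter> Z = {}"
    "\<And>p. set (sh p) \<inter> Z = {}"
    "\<And>\<gamma>. \<gamma> \<in> chords w \<Longrightarrow> index w' \<gamma> = index w \<gamma>" "\<And>\<gamma>. \<gamma> \<in> Z \<Longrightarrow> index w' \<gamma> = i \<gamma>"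
  shows "represents w' i (\<lambda>p. if p \<in> set w then sh p else [])"
proof -
  \<comment> \<open>At the endpoints of the new chords \<open>sh\<close> is unconstrained; they must
    be bare.\<close>
  let ?sh = "\<lambda>p. if p \<in> set w then sh p else []"
  have s: "shelling w sh" using assms(1) by (simp add: represents_def)
  note w = gauss_word_set[OF shelling_gauss_word[OF s]]
  have "shelling w' ?sh"
  proof (rule shellingI[OF assms(2)])
    fix p
    show "distinct (?sh p)" "set (?sh p) \<inter> chords w' = {}"
      using shellingD(1,2)[OF s, of p] assms(5)[of p] by (auto simp: assms(3))
    show "sign \<sigma> \<in> {1, - 1}" if "\<sigma> \<in> set (?sh p)" for \<sigma>
      using that shellingD(3)[OF s, of p \<sigma>] by (simp split: if_splits)
    show "set (?sh p) \<inter> set (?sh q) = {}" if "p \<noteq> q" for q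
      using that shelling_disjoint[OF s] by (cases "p \<in> set w"; cases "q \<in> set w") simp_all
  qed
  then show ?thesis
  proof (rule representsI)
    fix \<gamma> assume that: "\<gamma> \<in> chords w'"
    show "index w' \<gamma> - sign \<gamma> * shell_total ?sh \<gamma> = i \<gamma>"
    proof (cases "\<gamma> \<in> Z")
      case True
      then have "\<gamma> \<notin> chords w" using assms(4) by auto
      then have "shell_total ?sh \<gamma> = 0" by (auto simp: shell_total_def w)
      then show ?thesis using assms(7) True by simp
    next
      case False
      then have g: "\<gamma> \<in> chords w" using that assms(3) by auto
      then have "shell_total ?sh \<gamma> = shell_total sh \<gamma>" by (simp add: shell_total_def w)
      then show ?thesis using assms(6)[OF g] representsD(3)[OF assms(1) g] by simp
    qed
  qed
qed

lemma ind_equiv_R1: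
  assumes "gauss_word w" "\<gamma> \<notin> chords w" "sign \<gamma> \<in> {1, - 1}" "i \<gamma> = 0"
  shows "ind_equiv i w ([Ini \<gamma>, Ter \<gamma>] @ w)"
proof -
  let ?w' = "[Ini \<gamma>, Ter \<gamma>] @ w"
  have g': "gauss_word ?w'" by (rule gauss_word_add_chord[OF assms(1-3)])
  obtain sh where sh: "represents w i sh" "\<And>p. set (sh p) \<inter> {\<gamma>} = {}"
    using represents_exists[OF assms(1), of "{\<gamma>}" "{}" i] by blast
  let ?sh = "\<lambda>p. if p \<in> set w then sh p else []"
  have r: "represents ?w' i ?sh"
  proof (rule represents_extend[OF sh(1) g' _ _ sh(2)])
    show "index ?w' \<delta> = index w \<delta>" if "\<delta> \<in> chords w" for \<delta>
    proof -
      have "\<delta> \<in> chords ?w'" "\<delta> \<noteq> \<gamma>" using that assms(2) by auto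
      then show ?thesis
        unfolding index_eq_prefix_sum[OF assms(1) that] index_eq_prefix_sum[OF g' \<open>\<delta> \<in> chords ?w'\<close>] by simp
    qed
    show "index ?w' \<delta> = i \<delta>" if "\<delta> \<in> {\<gamma>}" for \<delta>
      using that assms(4) by (subst index_eq_prefix_sum[OF g']) auto
  qed (use assms(2) in auto)
  have "Ini \<gamma> \<notin> set w" "Ter \<gamma> \<notin> set w" using assms(2) by (auto simp: gauss_word_set[OF assms(1)])
  moreover have "expand w ?sh = expand w sh" by (rule expand_cong) simp
  ultimately have e: "expand ?w' ?sh = [Ini \<gamma>, Ter \<gamma>] @ expand w sh"
    by simp
  have "word_equiv (expand w sh) (expand ?w' ?sh)"
  proof (rule word_equiv_step)
    show "gauss_word (expand w sh)" "gauss_word (expand ?w' ?sh)"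
      using gauss_word_expand sh(1) r unfolding represents_def by blast+
    show "same_diagram (expand w sh) (expand ?w' ?sh) \<or> reidemeister_word (expand w sh) (expand ?w' ?sh)
        \<or> shell_word (expand w sh) (expand ?w' ?sh)"
      unfolding e using R1_ini_ter by blast
  qed
  then show ?thesis using sh(1) r unfolding ind_equiv_def by blast
qed

text \<open>The arc of \<open>a\<close> consists of \<open>Ini b\<close>, whose sign is
  \<open>- sign b = sign a\<close>, and \<open>u\<close>; the arc of \<open>b\<close> consists of
  \<open>u\<close> and \<open>Ter a\<close>. Hence the common value
  \<open>total u + sign a\<close>.\<close>

lemma ind_equiv_R2:
  assumes g': "gauss_word ([Ini a, Ini b] @ u @ [Ter a, Ter b] @ v)"
    and "sign b = - sign a" "i a = total u + sign a" "i b = i a"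
  shows "ind_equiv i (u @ v) ([Ini a, Ini b] @ u @ [Ter a, Ter b] @ v)"
proof -
  let ?w = "u @ v" and ?w' = "[Ini a, Ini b] @ u @ [Ter a, Ter b] @ v"
  have d: "a \<noteq> b" "Ini a \<notin> set ?w" "Ini b \<notin> set ?w" "Ter a \<notin> set ?w" "Ter b \<notin> set ?w"
    using g' by (auto simp: gauss_word_def)
  have g: "gauss_word ?w"
    unfolding gauss_word_def
  proof (intro conjI allI ballI)
    show "distinct ?w" using g' by (auto simp: gauss_word_def)
    have iff: "Ini \<gamma> \<in> set ?w' \<longleftrightarrow> Ter \<gamma> \<in> set ?w'" for \<gamma> using g' unfolding gauss_word_def by blast
    show "Ini \<gamma> \<in> set ?w \<longleftrightarrow> Ter \<gamma> \<in> set ?w" for \<gamma>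
      using d iff[of \<gamma>] by (cases "\<gamma> = a"; cases "\<gamma> = b") auto
    show "sign \<gamma> \<in> {1, - 1}" if "\<gamma> \<in> chords ?w" for \<gamma>
    proof -
      have "\<gamma> \<in> chords ?w'" using that by auto
      then show ?thesis using g' unfolding gauss_word_def by blast
    qed
  qed
  have ch: "chords ?w' = chords ?w \<union> {a, b}" by (simp add: chords_def) blast
  have new: "chords ?w \<inter> {a, b} = {}" using d by (auto simp: chords_def)
  obtain sh where sh: "represents ?w i sh" "\<And>p. set (sh p) \<inter> {a, b} = {}"
    using represents_exists[OF g, of "{a, b}" "{}" i] by blast
  let ?sh = "\<lambda>p. if p \<in> set ?w then sh p else []"
  have r: "represents ?w' i ?sh"
  proof (rule represents_extend[OF sh(1) g' ch new sh(2)])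
    show "index ?w' \<delta> = index ?w \<delta>" if "\<delta> \<in> chords ?w" for \<delta>
    proof -
      have mem: "\<delta> \<in> chords ?w'" "\<delta> \<noteq> a" "\<delta> \<noteq> b" using that ch new by auto
      then show ?thesis
        unfolding index_eq_prefix_sum[OF g' mem(1)] index_eq_prefix_sum[OF g that]
        using assms(2) by (simp add: prefix_sum_append)
    qed
    have mem: "a \<in> chords ?w'" "b \<in> chords ?w'" using ch by auto
    have "index ?w' a = total u + sign a" "index ?w' b = total u + sign a"
      unfolding index_eq_prefix_sum[OF g' mem(1)] index_eq_prefix_sum[OF g' mem(2)]
      using d assms(2) by (simp_all add: prefix_sum_append)
    then show "index ?w' \<delta> = i \<delta>" if "\<delta> \<in> {a, b}" for \<delta>
      using that assms(3,4) by auto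
  qed
  have eu: "expand u ?sh = expand u sh" "expand v ?sh = expand v sh"
    by (auto intro!: expand_cong)
  have e: "expand ?w' ?sh = [Ini a, Ini b] @ expand u sh @ [Ter a, Ter b] @ expand v sh"
    using d eu by simp
  have "word_equiv (expand ?w sh) (expand ?w' ?sh)"
  proof (rule word_equiv_step)
    show "gauss_word (expand ?w sh)" "gauss_word (expand ?w' ?sh)"
      using gauss_word_expand sh(1) r unfolding represents_def by blast+
    show "same_diagram (expand ?w sh) (expand ?w' ?sh) \<or> reidemeister_word (expand ?w sh) (expand ?w' ?sh)
        \<or> shell_word (expand ?w sh) (expand ?w' ?sh)"
      unfolding e expand_append[of u v sh] using R2_parallel[OF assms(2)] by blast
  qed
  then show ?thesis using sh(1) r unfolding ind_equiv_def by blast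
qed

text \<open>No move is made: one expanded word is read in two ways, with \<open>s\<close> as a shell
  of \<open>p\<close> or as a chord of the base word.\<close>

lemma ind_equiv_shell:
  assumes g: "gauss_word ([p] @ u)" and g': "gauss_word ([Ini s, p, Ter s] @ u)"
    and "endpoint_sign p = 1" "i s = 1"
  shows "ind_equiv i ([p] @ u) ([Ini s, p, Ter s] @ u)"
proof -
  let ?w = "[p] @ u" and ?w' = "[Ini s, p, Ter s] @ u"
  have d: "Ini s \<noteq> p" "Ter s \<noteq> p" "Ini s \<notin> set u" "Ter s \<notin> set u" "p \<notin> set u"
    using g' by (auto simp: gauss_word_def)
  have ch: "chords ?w' = insert s (chords ?w)" by (auto simp: chords_def)
  have new: "s \<notin> chords ?w" using d by (auto simp: chords_def)
  have ss: "sign s \<in> {1, - 1}" using g' ch unfolding gauss_word_def by blast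
  let ?d = "\<lambda>\<gamma>. if \<gamma> = chord_of p then sign s else 0"
  have index: "index ?w' \<gamma> = index ?w \<gamma> - sign \<gamma> * ?d \<gamma>" if "\<gamma> \<in> chords ?w" for \<gamma>
  proof -
    have mem: "\<gamma> \<in> chords ?w'" "\<gamma> \<noteq> s" using that ch new by auto
    show ?thesis
      unfolding index_eq_prefix_sum[OF g that] index_eq_prefix_sum[OF g' mem(1)]
      using mem(2) assms(3) by (cases p) auto
  qed
  have "s \<in> chords ?w'" using ch by simp
  then have index_s: "index ?w' s = 1"
    by (subst index_eq_prefix_sum[OF g']) (use d assms(3) in auto)
  have "\<not> (Ini \<gamma> \<in> {p} \<and> Ter \<gamma> \<in> {p})" for \<gamma> by auto
  \<comment> \<open>\<open>?d\<close> is the share of the total that \<open>s\<close> supplies when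
    read as a shell. With \<open>p\<close> bare, \<open>s\<close> becomes the only shell
    there.\<close>
  then obtain sh where sh: "shelling ?w sh" "\<And>\<gamma>. shell_total sh \<gamma> = sign \<gamma> * (index ?w \<gamma> - i \<gamma>) - ?d \<gamma>"
    "\<And>p. set (sh p) \<inter> {s} = {}" "sh p = []"
    using shelling_exists[OF g, of "{s}" "{p}" "\<lambda>\<gamma>. sign \<gamma> * (index ?w \<gamma> - i \<gamma>) - ?d \<gamma>"] by blast
  have "shelling ?w (sh(p := [s]))"
    by (rule shelling_fun_upd[OF sh(1)]) (use new ss sh(3) in auto)
  moreover have "shell_total (sh(p := [s])) \<gamma> = sign \<gamma> * (index ?w \<gamma> - i \<gamma>)" for \<gamma>
    using sh(2)[of \<gamma>] sh(4) by (cases p) (auto simp: shell_total_def)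
  ultimately have r: "represents ?w i (sh(p := [s]))"
    by (intro representsI) (simp_all only: gauss_word_sign_mult[OF g] diff_diff_eq2 add_diff_cancel_left')
  let ?sh = "\<lambda>r. if r \<in> set ?w then sh r else []"
  have r': "represents ?w' i ?sh"
  proof -
    have s': "shelling ?w' ?sh"
    proof (rule shellingI[OF g'])
      fix q
      show "distinct (?sh q)" "set (?sh q) \<inter> chords ?w' = {}"
        using shellingD(1,2)[OF sh(1), of q] sh(3)[of q] unfolding ch by auto
      show "sign \<sigma> \<in> {1, - 1}" if "\<sigma> \<in> set (?sh q)" for \<sigma>
        using that shellingD(3)[OF sh(1), of q \<sigma>] by (simp split: if_splits)
      show "set (?sh q) \<inter> set (?sh r) = {}" if "q \<noteq> r" for r
        using that shelling_disjoint[OF sh(1)] by (cases "q \<in> set ?w"; cases "r \<in> set ?w") simp_all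
    qed
    have "index ?w' \<gamma> - sign \<gamma> * shell_total ?sh \<gamma> = i \<gamma>" if "\<gamma> \<in> chords ?w'" for \<gamma>
    proof (cases "\<gamma> = s")
      case True
      then show ?thesis using index_s assms(4) d by (simp add: shell_total_def)
    next
      case False
      then have m: "\<gamma> \<in> chords ?w" using that ch by auto
      then have "shell_total ?sh \<gamma> = shell_total sh \<gamma>"
        using gauss_word_memD[OF g m] by (simp add: shell_total_def)
      then show ?thesis using gauss_word_sign_mult[OF g m, of "index ?w \<gamma> - i \<gamma>"]
        by (simp only: sh(2) index[OF m] right_diff_distrib)
    qed
    then show ?thesis using s' by (intro representsI)
  qed
  have "expand u ?sh = expand u sh" by (rule expand_cong) auto
  then have "expand ?w' ?sh = expand ?w (sh(p := [s]))"
    using d sh(4) assms(3) by (simp add: surround_single shelled_def)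
  then have "word_equiv (expand ?w (sh(p := [s]))) (expand ?w' ?sh)"
    using word_equiv_refl gauss_word_expand r unfolding represents_def by metis
  then show ?thesis using r r' unfolding ind_equiv_def by blast
qed

section \<open>Arbitrary permutations of the endpoints\<close>

lemma ind_equiv_swap_distinct:
  assumes "gauss_word (u @ [p, q] @ v)" "chord_of p \<noteq> chord_of q"
  shows "ind_equiv i (u @ [p, q] @ v) (u @ [q, p] @ v)"
proof -
  have g: "gauss_word ([p, q] @ v @ u)" "gauss_word (u @ [q, p] @ v)"
    using gauss_word_cong_mset[OF assms(1)] by simp_all
  have "ind_equiv i (u @ ([p, q] @ v)) (([p, q] @ v) @ u)" using assms(1) by (intro ind_equiv_rotate) simp
  then have 1: "ind_equiv i (u @ [p, q] @ v) ([p, q] @ v @ u)" by simp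
  have 2: "ind_equiv i ([p, q] @ v @ u) ([q, p] @ v @ u)"
    by (rule ind_equiv_swap_front[OF g(1) assms(2)])
  have "ind_equiv i (u @ ([q, p] @ v)) (([q, p] @ v) @ u)"
    by (rule ind_equiv_rotate) (use g(2) in simp)
  then have 3: "ind_equiv i ([q, p] @ v @ u) (u @ [q, p] @ v)" using ind_equiv_sym by simp
  show ?thesis by (rule ind_equiv_trans[OF 1 ind_equiv_trans[OF 2 3]])
qed

lemma ind_equiv_move:
  assumes "gauss_word (u @ q # r @ v)" "\<And>x. x \<in> set r \<Longrightarrow> chord_of x \<noteq> chord_of q"
  shows "ind_equiv i (u @ q # r @ v) (u @ r @ q # v)"
  using assms
proof (induction r arbitrary: u)
  case Nil
  then show ?case using ind_equiv_refl[OF Nil(1)] by simp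
next
  case (Cons x r)
  have "ind_equiv i (u @ [q, x] @ r @ v) (u @ [x, q] @ r @ v)"
    using Cons.prems(1) Cons.prems(2)[of x] by (intro ind_equiv_swap_distinct) auto
  then have 1: "ind_equiv i (u @ q # (x # r) @ v) ((u @ [x]) @ q # r @ v)" by simp
  have 2: "ind_equiv i ((u @ [x]) @ q # r @ v) ((u @ [x]) @ r @ q # v)"
    using Cons.prems gauss_word_cong_mset[OF Cons.prems(1), of "(u @ [x]) @ q # r @ v"]
    by (intro Cons.IH) simp_all
  show ?case using ind_equiv_trans[OF 1 2] by simp
qed

lemma ind_equiv_swap:
  assumes "gauss_word (u @ [p, q] @ v)"
  shows "ind_equiv i (u @ [p, q] @ v) (u @ [q, p] @ v)"
proof (cases "chord_of p = chord_of q")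
  case False
  then show ?thesis using ind_equiv_swap_distinct[OF assms] by simp
next
  case True
  have g: "gauss_word ([p] @ q # (v @ u) @ [])" "gauss_word (([p] @ v) @ (u @ [q]))"
    by (rule gauss_word_cong_mset[OF assms], simp)+
  have d: "p \<noteq> q" "p \<notin> set (v @ u)" "q \<notin> set (v @ u)" using assms by (auto simp: gauss_word_def)
  have "ind_equiv i (u @ ([p, q] @ v)) (([p, q] @ v) @ u)" using assms by (intro ind_equiv_rotate) simp
  then have 1: "ind_equiv i (u @ [p, q] @ v) ([p] @ q # (v @ u) @ [])" by simp
  have "ind_equiv i ([p] @ q # (v @ u) @ []) ([p] @ (v @ u) @ q # [])"
  proof (rule ind_equiv_move[OF g(1)])
    fix x assume "x \<in> set (v @ u)"
    then have "x \<noteq> p" "x \<noteq> q" using d by blast+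
    then show "chord_of x \<noteq> chord_of q" using same_chord_endpoints[OF _ True d(1)] by blast
  qed
  then have 2: "ind_equiv i ([p] @ q # (v @ u) @ []) (([p] @ v) @ (u @ [q]))" by simp
  have "ind_equiv i (([p] @ v) @ (u @ [q])) ((u @ [q]) @ ([p] @ v))"
    by (rule ind_equiv_rotate[OF g(2)])
  then have 3: "ind_equiv i (([p] @ v) @ (u @ [q])) (u @ [q, p] @ v)" by simp
  show ?thesis by (rule ind_equiv_trans[OF 1 ind_equiv_trans[OF 2 3]])
qed

lemma ind_equiv_bubble:
  assumes "gauss_word (u @ a @ x # b)"
  shows "ind_equiv i (u @ a @ x # b) (u @ x # a @ b)"
  using assms
proof (induction a arbitrary: b rule: rev_induct)
  case Nil
  then show ?case using ind_equiv_refl[OF Nil(1)] by simp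
next
  case (snoc y a)
  have "ind_equiv i ((u @ a) @ [y, x] @ b) ((u @ a) @ [x, y] @ b)"
    using snoc.prems by (intro ind_equiv_swap) simp
  then have 1: "ind_equiv i (u @ (a @ [y]) @ x # b) (u @ a @ x # (y # b))" by simp
  have 2: "ind_equiv i (u @ a @ x # (y # b)) (u @ x # a @ (y # b))"
    using gauss_word_cong_mset[OF snoc.prems, of "u @ a @ x # (y # b)"] by (intro snoc.IH) simp
  show ?case using ind_equiv_trans[OF 1 2] by simp
qed

text \<open>\<open>u\<close> is the part already in its final order; it grows during the induction
  along \<open>w'\<close>.\<close>

lemma ind_equiv_permute:
  assumes "gauss_word (u @ w)" "mset w = mset w'"
  shows "ind_equiv i (u @ w) (u @ w')"
  using assms
proof (induction w' arbitrary: u w)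
  case Nil
  then show ?case using ind_equiv_refl[OF Nil(1)] by simp
next
  case (Cons x w')
  have "x \<in> set w" using mset_eq_setD[OF Cons.prems(2)] by simp
  then obtain a b where w: "w = a @ x # b" by (meson split_list)
  have 1: "ind_equiv i (u @ a @ x # b) (u @ x # a @ b)"
    using Cons.prems(1) by (intro ind_equiv_bubble) (simp add: w)
  have "ind_equiv i ((u @ [x]) @ (a @ b)) ((u @ [x]) @ w')"
    using Cons.prems(2) gauss_word_cong_mset[OF Cons.prems(1), of "(u @ [x]) @ (a @ b)"]
    by (intro Cons.IH) (simp_all add: w)
  then have 2: "ind_equiv i (u @ x # a @ b) (u @ x # w')" by simp
  show ?case unfolding w by (rule ind_equiv_trans[OF 1 2])
qed

lemma ind_equiv_same_chords:
  assumes "gauss_word w" "gauss_word w'" "chords w = chords w'"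
  shows "ind_equiv i w w'"
proof -
  have "set w = set w'" unfolding gauss_word_set[OF assms(1)] gauss_word_set[OF assms(2)] assms(3) ..
  then have "mset w = mset w'"
    using assms(1,2) set_eq_iff_mset_eq_distinct unfolding gauss_word_def by blast
  then show ?thesis using ind_equiv_permute[of "[]" w w'] assms(1) by simp
qed

section \<open>Cancellation\<close>

lemma gauss_word_signs: "gauss_word w \<Longrightarrow> \<gamma> \<in> chords w \<Longrightarrow> sign \<gamma> \<in> {1, - 1}"
  unfolding gauss_word_def by blast

text \<open>\<open>c = 1\<close> yields a renamed copy, \<open>c = - 1\<close> a copy that cancels
  the original in every count by index.\<close>

lemma fresh_copy:
  assumes "finite A"
  shows "\<exists>f. inj_on f C \<and> f ` C \<inter> A = {} \<and> (\<forall>\<gamma>\<in>C. sign (f \<gamma>) = c * sign \<gamma>)"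
proof -
  obtain N where N: "\<And>m s. m \<ge> N \<Longrightarrow> (m, s) \<notin> A"
    using fresh_names[OF assms] by blast
  let ?f = "\<lambda>\<gamma>::chord. (N + to_nat \<gamma>, c * sign \<gamma>)"
  have "inj_on ?f C" by (auto intro: inj_onI)
  moreover have "?f \<gamma> \<notin> A" for \<gamma> using N by simp
  then have "?f ` C \<inter> A = {}" by blast
  ultimately show ?thesis by (intro exI[of _ ?f]) simp
qed

lemma fresh_positive_chords:
  assumes "finite A"
  shows "\<exists>ts. distinct ts \<and> length ts = n \<and> set ts \<inter> A = {} \<and> (\<forall>t\<in>set ts. sign t = 1)"
proof -
  obtain N where N: "\<And>m s. m \<ge> N \<Longrightarrow> (m, s) \<notin> A"
    using fresh_names[OF assms] by blast
  let ?ts = "map (\<lambda>j. (N + j, 1)) [0..<n]"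
  have "distinct ?ts" by (simp add: distinct_map inj_on_def)
  moreover have "set ?ts \<inter> A = {}" using N by auto
  ultimately show ?thesis by (intro exI[of _ ?ts]) simp
qed

lemma gauss_word_add_chords:
  assumes "gauss_word w" "distinct ts" "set ts \<inter> chords w = {}" "\<And>t. t \<in> set ts \<Longrightarrow> sign t \<in> {1, - 1}"
  shows "gauss_word (map Ini ts @ map Ter ts @ w)"
  using assms
proof (induction ts)
  case Nil
  then show ?case by simp
next
  case (Cons t ts)
  have "chords (map Ini ts @ map Ter ts @ w) = set ts \<union> chords w" by (auto simp: chords_def)
  then have "gauss_word ([Ini t, Ter t] @ (map Ini ts @ map Ter ts @ w))"
    using Cons by (intro gauss_word_add_chord) auto
  then show ?case by (rule gauss_word_cong_mset) simp
qed

text \<open>By \<open>ind_equiv_same_chords\<close> the position of a chord is free, so a chord of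
  prescribed index 0 may be taken with adjacent endpoints and without shells, where R1 inserts
  it.\<close>

lemma ind_equiv_index_zero:
  assumes "finite T" "gauss_word w" "gauss_word w'" "chords w' = chords w \<union> T" "chords w \<inter> T = {}"
    "\<And>t. t \<in> T \<Longrightarrow> i t = 0"
  shows "ind_equiv i w w'"
  using assms
proof (induction T arbitrary: w')
  case empty
  then show ?case by (intro ind_equiv_same_chords) simp_all
next
  case (insert t T)
  have sgn: "sign \<gamma> \<in> {1, - 1}" if "\<gamma> \<in> insert t (chords w \<union> T)" for \<gamma>
    using gauss_word_signs[OF insert.prems(2)] that insert.prems(3) by blast
  obtain w1 where w1: "gauss_word w1" "chords w1 = chords w \<union> T"
    using gauss_word_exists[of "chords w \<union> T"] sgn insert.hyps(1) by (metis finite_Un finite_chords insertI2)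
  have t: "t \<notin> chords w1" using insert.hyps(2) insert.prems(4) w1(2) by blast
  have st: "sign t \<in> {1, - 1}" using sgn by blast
  have 1: "ind_equiv i w w1"
    using insert.prems w1 by (intro insert.IH) auto
  have 2: "ind_equiv i w1 ([Ini t, Ter t] @ w1)"
    using insert.prems(5) by (intro ind_equiv_R1 w1(1) t st) simp
  have 3: "ind_equiv i ([Ini t, Ter t] @ w1) w'"
    using insert.prems(2,3) w1 gauss_word_add_chord[OF w1(1) t st] by (intro ind_equiv_same_chords) auto
  show ?case by (rule ind_equiv_trans[OF 1 ind_equiv_trans[OF 2 3]])
qed

text \<open>
  Auxiliary chords of index zero provide an arc along which two chords of opposite signs can be
  drawn in parallel without shells.
\<close>

lemma ind_equiv_opposite_pair:
  assumes "gauss_word w" "gauss_word w'" "chords w' = chords w \<union> {a, b}" "a \<notin> chords w" "b \<notin> chords w"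
    "sign b = - sign a" "i b = i a"
  shows "ind_equiv i w w'"
proof -
  \<comment> \<open>The sign sum that the arc \<open>u\<close> must have for \<open>a\<close> to
    attain index \<open>i a\<close> without shells, see \<open>ind_equiv_R2\<close>. Each auxiliary
    chord puts one endpoint on \<open>u\<close>: the terminal one if \<open>d\<close> is
    nonnegative, the initial one otherwise.\<close>
  define d where "d = i a - sign a"
  obtain ts where ts: "distinct ts" "length ts = nat \<bar>d\<bar>" "set ts \<inter> chords w' = {}" "\<forall>t\<in>set ts. sign t = 1"
    using fresh_positive_chords[of "chords w'" "nat \<bar>d\<bar>"] by auto
  \<comment> \<open>The auxiliary chords are new, so \<open>i\<close> can be overridden there
    without affecting \<open>w\<close> and \<open>w'\<close>.\<close>
  define j where "j \<gamma> = (if \<gamma> \<in> set ts then 0 else i \<gamma>)" for \<gamma>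
  define u where "u = (if d \<ge> 0 then map Ter ts else map Ini ts)"
  define v where "v = (if d \<ge> 0 then map Ini ts else map Ter ts) @ w"
  have s: "sign a \<in> {1, - 1}" "sign b \<in> {1, - 1}"
    using gauss_word_signs[OF assms(2)] assms(3) by blast+
  have ab: "a \<noteq> b" using s(1) assms(6) by auto
  have "map sign ts = map (\<lambda>_. 1) ts" using ts(4) by simp
  then have "sign_sum ts = \<bar>d\<bar>" using ts(2) by (simp only: sum_list_triv of_nat_nat abs_ge_zero mult_1_right of_int_eq_id id_apply)
  moreover have "total (map Ter ts) = sign_sum ts" "total (map Ini ts) = - sign_sum ts"
    by (induction ts) auto
  ultimately have tot: "total u = d" by (simp add: u_def)
  have "mset (map Ini ts @ map Ter ts @ w) = mset (u @ v)" by (simp add: u_def v_def)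
  moreover have "gauss_word (map Ini ts @ map Ter ts @ w)"
    using ts assms(3) by (intro gauss_word_add_chords assms(1)) auto
  ultimately have g: "gauss_word (u @ v)" using gauss_word_cong_mset by blast
  have ch: "chords (u @ v) = chords w \<union> set ts"
    by (auto simp: u_def v_def chords_def)
  have new: "a \<notin> chords (u @ v)" "b \<notin> chords (u @ v)" using assms(3-5) ts(3) ch by auto
  let ?W = "[Ini a, Ini b] @ u @ [Ter a, Ter b] @ v"
  have gb: "gauss_word ([Ini b, Ter b] @ (u @ v))" by (rule gauss_word_add_chord[OF g new(2) s(2)])
  have "gauss_word ([Ini a, Ter a] @ ([Ini b, Ter b] @ (u @ v)))"
    using new(1) ab by (intro gauss_word_add_chord[OF gb _ s(1)]) auto
  then have gW: "gauss_word ?W" by (rule gauss_word_cong_mset) simp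
  have chW: "chords ?W = chords w' \<union> set ts" using assms(3) ch by auto
  have zero: "j t = 0" if "t \<in> set ts" for t using that by (simp add: j_def)
  have jab: "j a = i a" "j b = i a" using new ch assms(7) by (auto simp: j_def)
  have 1: "ind_equiv j w (u @ v)"
    using ts(3) assms(3) by (intro ind_equiv_index_zero[where T = "set ts"] assms(1) g ch zero) auto
  have 2: "ind_equiv j (u @ v) ?W"
    by (rule ind_equiv_R2[OF gW assms(6)]) (simp_all add: jab tot d_def)
  have 3: "ind_equiv j w' ?W"
    using ts(3) by (intro ind_equiv_index_zero[where T = "set ts"] assms(2) gW chW zero) auto
  have "ind_equiv j w w'"
    by (rule ind_equiv_trans[OF ind_equiv_trans[OF 1 2] ind_equiv_sym[OF 3]])
  moreover have "j \<gamma> = i \<gamma>" if "\<gamma> \<in> chords w \<union> chords w'" for \<gamma>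
    using that ts(3) assms(3) by (auto simp: j_def)
  ultimately show ?thesis using ind_equiv_cong by metis
qed

text \<open>To be read as a shell, \<open>s\<close> needs a positive endpoint to surround. The
  auxiliary chord \<open>t\<close> of index zero provides \<open>Ter t\<close>, even when
  \<open>w\<close> is empty.\<close>

lemma ind_equiv_index_one:
  assumes "gauss_word w" "gauss_word w'" "chords w' = chords w \<union> {s}" "s \<notin> chords w" "i s = 1"
  shows "ind_equiv i w w'"
proof -
  obtain ts where "distinct ts" "length ts = 1" and ts: "set ts \<inter> chords w' = {}" "\<forall>t\<in>set ts. sign t = 1"
    using fresh_positive_chords[of "chords w'" 1] by auto
  then obtain t where "ts = [t]" by (auto simp: length_Suc_conv)
  then have t: "t \<notin> chords w'" "sign t = 1" using ts by auto
  let ?j = "i(t := 0)"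
  let ?v = "[Ter t] @ (Ini t # w)" and ?W = "[Ini s, Ter t, Ter s] @ (Ini t # w)"
  have g1: "gauss_word ([Ini t, Ter t] @ w)"
    using t assms(3) by (intro gauss_word_add_chord assms(1)) auto
  have ss: "sign s \<in> {1, - 1}" using gauss_word_signs[OF assms(2)] assms(3) by blast
  have g: "gauss_word ?v" using g1 by (rule gauss_word_cong_mset) simp
  have "s \<noteq> t" using t assms(3) by auto
  then have "gauss_word ([Ini s, Ter s] @ ([Ini t, Ter t] @ w))"
    using assms(4) by (intro gauss_word_add_chord[OF g1 _ ss]) auto
  then have gW: "gauss_word ?W" by (rule gauss_word_cong_mset) simp
  have ch: "chords ?v = chords w \<union> {t}" "chords ?W = chords w' \<union> {t}" using assms(3) by auto
  have 1: "ind_equiv ?j w ?v"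
    using t assms(3) by (intro ind_equiv_index_zero[where T = "{t}"] assms(1) g ch) auto
  have 2: "ind_equiv ?j ?v ?W"
    by (rule ind_equiv_shell[OF g gW]) (use t(2) assms(5) \<open>s \<noteq> t\<close> in simp_all)
  have 3: "ind_equiv ?j w' ?W"
    using t by (intro ind_equiv_index_zero[where T = "{t}"] assms(2) gW ch) auto
  have "ind_equiv ?j w w'"
    by (rule ind_equiv_trans[OF ind_equiv_trans[OF 1 2] ind_equiv_sym[OF 3]])
  moreover have "?j \<gamma> = i \<gamma>" if "\<gamma> \<in> chords w \<union> chords w'" for \<gamma>
    using that t(1) assms(3) by auto
  ultimately show ?thesis using ind_equiv_cong by metis
qed

section \<open>Counting chords by index, and enlargement by chords of vanishing count\<close>

definition index_count :: "(chord \<Rightarrow> int) \<Rightarrow> chord set \<Rightarrow> int \<Rightarrow> int" where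
  "index_count i C n = (\<Sum>\<gamma>\<in>C. if i \<gamma> = n then sign \<gamma> else 0)"

lemma index_count_union:
  "finite C \<Longrightarrow> finite D \<Longrightarrow> C \<inter> D = {} \<Longrightarrow> index_count i (C \<union> D) n = index_count i C n + index_count i D n"
  by (simp add: index_count_def sum.union_disjoint)

lemma index_count_cong:
  "(\<And>\<gamma>. \<gamma> \<in> C \<Longrightarrow> i \<gamma> = j \<gamma>) \<Longrightarrow> index_count i C n = index_count j C n"
  by (simp add: index_count_def cong: sum.cong)

lemma index_count_image:
  assumes "inj_on f C" "\<And>\<gamma>. \<gamma> \<in> C \<Longrightarrow> sign (f \<gamma>) = c * sign \<gamma>" "\<And>\<gamma>. \<gamma> \<in> C \<Longrightarrow> j (f \<gamma>) = i \<gamma>"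
  shows "index_count j (f ` C) n = c * index_count i C n"
  unfolding index_count_def sum.reindex[OF assms(1)] o_def sum_distrib_left
  by (rule sum.cong) (simp_all add: assms(2,3))

text \<open>\<open>Z\<close> is used up in pieces. Chords of index 0 or 1 are inserted singly; if
  another index occurs, its vanishing count forces chords of both signs with that index, and these
  form a pair for \<open>ind_equiv_opposite_pair\<close>.\<close>

lemma ind_equiv_null:
  assumes "finite Z" "gauss_word w" "gauss_word w'" "chords w' = chords w \<union> Z" "chords w \<inter> Z = {}"
    "\<And>n. n \<noteq> 0 \<Longrightarrow> n \<noteq> 1 \<Longrightarrow> index_count i Z n = 0"
  shows "ind_equiv i w w'"
  using assms
proof (induction Z arbitrary: w' rule: finite_psubset_induct)
  case (psubset Z)
  \<comment> \<open>\<open>X\<close> is the piece split off. Its counts vanish, hence so do those of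
    \<open>Z - X\<close>, to which the induction hypothesis applies.\<close>
  have step: "\<exists>w1. gauss_word w1 \<and> chords w1 = chords w \<union> (Z - X) \<and> ind_equiv i w w1"
    if X: "X \<subseteq> Z" "X \<noteq> {}" "\<And>n. n \<noteq> 0 \<Longrightarrow> n \<noteq> 1 \<Longrightarrow> index_count i X n = 0" for X
  proof -
    have sgn: "sign \<gamma> \<in> {1, - 1}" if "\<gamma> \<in> chords w \<union> (Z - X)" for \<gamma>
      using gauss_word_signs[OF psubset.prems(2)] that psubset.prems(3) by blast
    obtain w1 where w1: "gauss_word w1" "chords w1 = chords w \<union> (Z - X)"
      using gauss_word_exists[OF _ sgn] psubset.hyps by (metis finite_Diff finite_Un finite_chords)
    have fin: "finite X" "finite (Z - X)" using psubset.hyps X(1) finite_subset by auto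
    have "index_count i (Z - X) n = 0" if "n \<noteq> 0" "n \<noteq> 1" for n
      using index_count_union[OF fin, of i n] X(3)[OF that] psubset.prems(5)[OF that] X(1)
      by (simp add: Un_absorb1)
    then have "ind_equiv i w w1"
      using X(1,2) psubset.prems(1,4) w1 by (intro psubset.IH[of "Z - X"]) auto
    then show ?thesis using w1 by blast
  qed
  show ?case
  proof (cases "Z = {}")
    case True
    then show ?thesis using psubset.prems by (intro ind_equiv_same_chords) simp_all
  next
    case False
    then obtain \<gamma> where \<gamma>: "\<gamma> \<in> Z" by blast
    show ?thesis
    proof (cases "i \<gamma> = 0 \<or> i \<gamma> = 1")
      case True
      then have "\<exists>w1. gauss_word w1 \<and> chords w1 = chords w \<union> (Z - {\<gamma>}) \<and> ind_equiv i w w1"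
        using \<gamma> by (intro step) (auto simp: index_count_def)
      then obtain w1 where w1: "gauss_word w1" "chords w1 = chords w \<union> (Z - {\<gamma>})" "ind_equiv i w w1"
        by blast
      have c: "chords w' = chords w1 \<union> {\<gamma>}" "\<gamma> \<notin> chords w1"
        using w1(2) psubset.prems(3,4) \<gamma> by auto
      have "ind_equiv i w1 w'"
        using True
      proof
        assume "i \<gamma> = 0"
        then show ?thesis
          using c by (intro ind_equiv_index_zero[where T = "{\<gamma>}"] w1(1) psubset.prems(2)) auto
      next
        assume "i \<gamma> = 1"
        then show ?thesis
          by (intro ind_equiv_index_one[OF w1(1) psubset.prems(2) c])
      qed
      then show ?thesis by (rule ind_equiv_trans[OF w1(3)])
    next
      case False
      have sgn: "sign \<delta> = 1 \<or> sign \<delta> = - 1" if "\<delta> \<in> Z" for \<delta>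
        using gauss_word_signs[OF psubset.prems(2)] that psubset.prems(3) by blast
      have "\<exists>\<delta>\<in>Z. i \<delta> = i \<gamma> \<and> sign \<delta> = - sign \<gamma>"
      proof (rule ccontr)
        assume no: "\<not> ?thesis"
        have "sign \<delta> = sign \<gamma>" if "\<delta> \<in> Z" "i \<delta> = i \<gamma>" for \<delta>
          using no that sgn[of \<delta>] sgn[OF \<gamma>] by auto
        then have "index_count i Z (i \<gamma>) = (\<Sum>\<delta>\<in>Z. sign \<gamma> * (if i \<delta> = i \<gamma> then 1 else 0))"
          unfolding index_count_def by (intro sum.cong) auto
        also have "\<dots> = sign \<gamma> * int (card {\<delta> \<in> Z. i \<delta> = i \<gamma>})"
          using psubset.hyps by (simp add: sum_distrib_left[symmetric] sum.If_cases Int_def)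
        also have "\<dots> \<noteq> 0"
          using sgn[OF \<gamma>] \<gamma> psubset.hyps by auto
        finally show False using psubset.prems(5)[of "i \<gamma>"] False by simp
      qed
      then obtain \<delta> where \<delta>: "\<delta> \<in> Z" "i \<delta> = i \<gamma>" "sign \<delta> = - sign \<gamma>" by blast
      have "\<gamma> \<noteq> \<delta>" using \<delta>(3) sgn[OF \<gamma>] by auto
      then have "\<exists>w1. gauss_word w1 \<and> chords w1 = chords w \<union> (Z - {\<gamma>, \<delta>}) \<and> ind_equiv i w w1"
        using \<gamma> \<delta> by (intro step) (auto simp: index_count_def)
      then obtain w1 where w1: "gauss_word w1" "chords w1 = chords w \<union> (Z - {\<gamma>, \<delta>})" "ind_equiv i w w1"
        by blast
      have c: "chords w' = chords w1 \<union> {\<gamma>, \<delta>}" "\<gamma> \<notin> chords w1" "\<delta> \<notin> chords w1"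
        using w1(2) psubset.prems(3,4) \<gamma> \<delta>(1) by auto
      show ?thesis
        by (rule ind_equiv_trans[OF w1(3) ind_equiv_opposite_pair[OF w1(1) psubset.prems(2) c \<delta>(3,2)]])
    qed
  qed
qed

text \<open>Let C and D be the two sets of chords and C* a fresh copy of C with opposite signs. The
  word \<open>W\<close> on C, C* and D extends \<open>w\<close> by C* and D, and \<open>w'\<close>
  by C and C*. Both extensions have vanishing counts, so \<open>ind_equiv_null\<close> links each
  word to \<open>W\<close>.\<close>

lemma ind_equiv_disjoint:
  assumes g: "gauss_word w" "gauss_word w'" and dj: "chords w \<inter> chords w' = {}"
    and eq: "\<And>n. n \<noteq> 0 \<Longrightarrow> n \<noteq> 1 \<Longrightarrow> index_count i (chords w) n = index_count i (chords w') n"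
  shows "ind_equiv i w w'"
proof -
  let ?C = "chords w" and ?D = "chords w'"
  obtain f where f: "inj_on f ?C" "f ` ?C \<inter> (?C \<union> ?D) = {}" "\<forall>\<gamma>\<in>?C. sign (f \<gamma>) = - 1 * sign \<gamma>"
  proof -
    have "finite (?C \<union> ?D)" by simp
    from fresh_copy[OF this, of ?C "- 1"] show thesis by (elim exE conjE) (rule that; assumption)
  qed
  define j where "j \<gamma> = (if \<gamma> \<in> f ` ?C then i (inv_into ?C f \<gamma>) else i \<gamma>)" for \<gamma>
  have j: "j \<gamma> = i \<gamma>" if "\<gamma> \<in> ?C \<union> ?D" for \<gamma>
    using that f(2) by (auto simp: j_def)
  have jf: "j (f \<gamma>) = i \<gamma>" if "\<gamma> \<in> ?C" for \<gamma>
    using that f(1) by (simp add: j_def)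
  have count: "index_count j (f ` ?C) n = - index_count j ?C n" for n
    using index_count_image[OF f(1), of "- 1" j i n] f(3) jf index_count_cong[of ?C j i n] j by simp
  have sgn: "sign \<gamma> \<in> {1, - 1}" if "\<gamma> \<in> ?C \<union> f ` ?C \<union> ?D" for \<gamma>
  proof -
    have "sign (f \<delta>) \<in> {1, - 1}" if "\<delta> \<in> ?C" for \<delta>
      using f(3) that gauss_word_signs[OF g(1) that] by auto
    then show ?thesis using that gauss_word_signs[OF g(1)] gauss_word_signs[OF g(2)] by blast
  qed
  obtain W where W: "gauss_word W" "chords W = ?C \<union> f ` ?C \<union> ?D"
    using gauss_word_exists[OF _ sgn] by (metis finite_Un finite_chords finite_imageI)
  have eq': "index_count j ?C n = index_count j ?D n" if "n \<noteq> 0" "n \<noteq> 1" for n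
    using eq[OF that] index_count_cong[of ?C j i n] index_count_cong[of ?D j i n] j by simp
  have 1: "ind_equiv j w W"
  proof (rule ind_equiv_null[where Z = "f ` ?C \<union> ?D"])
    show "index_count j (f ` ?C \<union> ?D) n = 0" if "n \<noteq> 0" "n \<noteq> 1" for n
      using index_count_union[of "f ` ?C" ?D j n] count[of n] eq'[OF that] f(2) by (simp add: Int_Un_distrib)
  qed (use g W dj f(2) in auto)
  have 2: "ind_equiv j w' W"
  proof (rule ind_equiv_null[where Z = "?C \<union> f ` ?C"])
    show "index_count j (?C \<union> f ` ?C) n = 0" for n
      using index_count_union[of ?C "f ` ?C" j n] count[of n] f(2) by (simp add: Int_Un_distrib Int_commute)
  qed (use g W dj f(2) in auto)
  have "ind_equiv j w w'" by (rule ind_equiv_trans[OF 1 ind_equiv_sym[OF 2]])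
  then show ?thesis using ind_equiv_cong[of w w' j i] j by blast
qed

section \<open>From equal writhes to equivalence of diagrams\<close>

lemma represents_no_shells: "gauss_word w \<Longrightarrow> (\<And>\<gamma>. \<gamma> \<in> chords w \<Longrightarrow> i \<gamma> = index w \<gamma>) \<Longrightarrow> represents w i (\<lambda>_. [])"
  by (simp add: represents_def shelling_def shell_total_def)

text \<open>\<open>w\<close> and \<open>w'\<close> may use one name for chords of different indices,
  so no single index function need serve both. Each of them is instead compared with a copy
  \<open>v\<close> of \<open>w\<close> under fresh names, decorated with shells that give its chords
  the indices they have in \<open>w\<close>.\<close>

lemma word_equiv_if_writhe_eq:
  assumes g: "gauss_word w" "gauss_word w'" and eq: "\<And>n. n \<noteq> 0 \<Longrightarrow> writhe w n = writhe w' n"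
  shows "word_equiv w w'"
proof -
  let ?C = "chords w" and ?D = "chords w'"
  obtain f where f: "inj_on f ?C" "f ` ?C \<inter> (?C \<union> ?D) = {}" "\<forall>\<gamma>\<in>?C. sign (f \<gamma>) = 1 * sign \<gamma>"
  proof -
    have "finite (?C \<union> ?D)" by simp
    from fresh_copy[OF this, of ?C 1] show thesis by (elim exE conjE) (rule that; assumption)
  qed
  have "sign (f \<gamma>) \<in> {1, - 1}" if "\<gamma> \<in> ?C" for \<gamma>
    using f(3) that gauss_word_signs[OF g(1) that] by simp
  then have img: "\<And>\<gamma>. \<gamma> \<in> f ` ?C \<Longrightarrow> sign \<gamma> \<in> {1, - 1}" by blast
  obtain v where v: "gauss_word v" "chords v = f ` ?C"
  proof -
    have "\<exists>v. gauss_word v \<and> chords v = f ` ?C"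
      by (rule gauss_word_exists[OF _ img]) simp_all
    then show thesis by (elim exE conjE) (rule that; assumption)
  qed
  \<comment> \<open>On the copied chords \<open>k u\<close> is the index in \<open>w\<close> of the
    original; on the others it is the index in \<open>u\<close>, so that \<open>u\<close> represents
    \<open>k u\<close> without shells.\<close>
  define k where "k u \<gamma> = (if \<gamma> \<in> f ` ?C then index w (inv_into ?C f \<gamma>) else index u \<gamma>)" for u \<gamma>
  have count_v: "index_count (k u) (chords v) n = writhe w n" for u n
  proof -
    have "k u (f \<gamma>) = index w \<gamma>" if "\<gamma> \<in> ?C" for \<gamma> using that f(1) by (simp add: k_def)
    then show ?thesis
      unfolding v(2) using index_count_image[OF f(1), of 1 "k u" "index w" n] f(3)
      by (simp add: index_count_def writhe_eq)
  qed
  have k: "k u \<gamma> = index u \<gamma>" if "\<gamma> \<in> ?C \<union> ?D" for u \<gamma>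
    using that f(2) by (auto simp: k_def)
  have count: "index_count (k u) (chords u) n = writhe u n" if "chords u \<subseteq> ?C \<union> ?D" for u n
  proof -
    have "index_count (k u) (chords u) n = index_count (index u) (chords u) n"
      using that by (intro index_count_cong k) blast
    then show ?thesis by (simp only: index_count_def writhe_eq)
  qed
  obtain sh where sh: "represents v (k w) sh"
    using represents_exists[OF v(1), of "{}" "{}"] by blast
  \<comment> \<open>All \<open>k u\<close> agree on the chords of \<open>v\<close>. Hence one
    decorated word \<open>expand v sh\<close> serves as the common target of \<open>w\<close> and
    \<open>w'\<close>.\<close>
  have sh': "represents v (k u) sh" for u
    using sh represents_cong[of v "k w" "k u"] by (simp add: v(2) k_def)
  have "word_equiv u (expand v sh)"
    if u: "gauss_word u" "chords u \<subseteq> ?C \<union> ?D" "\<And>n. n \<noteq> 0 \<Longrightarrow> writhe u n = writhe w n" for u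
  proof -
    have "ind_equiv (k u) u v"
    proof (rule ind_equiv_disjoint[OF u(1) v(1)])
      show "chords u \<inter> chords v = {}" using u(2) f(2) v(2) by auto
    qed (simp add: count[OF u(2)] count_v u(3))
    moreover have "represents u (k u) (\<lambda>_. [])"
      using u(2) k by (intro represents_no_shells[OF u(1)]) blast
    ultimately have "word_equiv (expand u (\<lambda>_. [])) (expand v sh)"
      using sh' by (rule ind_equivD)
    then show ?thesis by (simp add: expand_no_shells)
  qed
  note this[of w] and this[of w']
  then have "word_equiv w (expand v sh)" "word_equiv w' (expand v sh)"
    using g eq by simp_all
  then show ?thesis using word_equiv_trans[OF _ word_equiv_sym] by blast
qed

lemma writhe_poly_diagram_eq_iff:
  "writhe_poly_diagram G = writhe_poly_diagram G' \<longleftrightarrow> shell_equiv G G'"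
proof
  assume "writhe_poly_diagram G = writhe_poly_diagram G'"
  then have "writhe (endpoints G) n = writhe (endpoints G') n" if "n \<noteq> 0" for n
    using lookup_writhe_poly_word[OF that] by (metis writhe_poly_diagram.rep_eq)
  then have "word_equiv (endpoints G) (endpoints G')"
    using endpoints by (intro word_equiv_if_writhe_eq) auto
  then show "shell_equiv G G'" by (simp add: word_equiv_def endpoints_inverse)
qed (rule writhe_poly_diagram_shell_equiv)

theorem theorem1p1:
  fixes K K' :: virtual_knot
  shows "writhe_poly K = writhe_poly K' \<longleftrightarrow> shell_related K K'"
proof -
  obtain G G' where G: "K = virtual_knot_of G" "K' = virtual_knot_of G'"
    by (metis Quotient3_virtual_knot Quotient3_abs_rep)
  have "writhe_poly K = writhe_poly K' \<longleftrightarrow> shell_equiv G G'"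
    unfolding G writhe_poly.abs_eq by (rule writhe_poly_diagram_eq_iff)
  also have "\<dots> \<longleftrightarrow> shell_related K K'"
  proof
    assume "shell_equiv G G'"
    then show "shell_related K K'" unfolding shell_related_def G by blast
  next
    assume "shell_related K K'"
    then show "shell_equiv G G'" unfolding shell_related_iff_any_diagrams G by blast
  qed
  finally show ?thesis .
qed

end
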